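(* Let $G$ be a direct sum of a countable family $\{G_i:i\in I\}$ of finitely generated abelian groups (not necessarily distinct). Then there exists a pure Krull domain $R$ with $\mathbb{Z}[X]\subseteq R\subseteq\mathbb{Q}[X]$ such that $\mathrm{Cl}(R)\cong G$. Moreover, for each $i\in I$ there is a multiplicative subset $S_i$ of $\mathbb{Z}$ such that $R_{S_i}$ is a pure Krull domain with $\mathrm{Cl}(R_{S_i})\cong G_i$.
   Context: A polynomial Krull domain is a Krull domain $R$ with $\mathbb{Z}[X]\subseteq R\subseteq\mathbb{Q}[X]$. It is pure if no height-one prime ideal $Q$ of $R$ with $Q\cap\mathbb{Z}\neq(0)$ is a maximal ideal of $R$. $\mathrm{Cl}(R)$ denotes the divisor class group of the Krull domain $R$, and $R_{S}$ the localization $S^{-1}R$. *)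

theory Defs
  imports "HOL-Algebra.Algebra" "HOL-Computational_Algebra.Polynomial"
          "HOL-Computational_Algebra.Fraction_Field"
begin

text \<open>All rings considered are subrings R of Q[X], represented as sets R :: rat poly set.
  Their common fraction field is K = Q(X), represented by the type rat poly fract.\<close>

type_synonym qfun = "rat poly fract"

definition emb :: "rat poly \<Rightarrow> qfun" where
  "emb p = Fraction_Field.Fract p 1"

definition ZX :: "rat poly set" where
  "ZX = {p. \<forall>i. coeff p i \<in> \<int>}"

text \<open>Discrete (rank one, normalized) valuation of K = Q(X); values at 0 are irrelevant.\<close>
definition discrete_valuation :: "(qfun \<Rightarrow> int) \<Rightarrow> bool" where
  "discrete_valuation v \<longleftrightarrow>
     (\<forall>x y. x \<noteq> 0 \<longrightarrow> y \<noteq> 0 \<longrightarrow> v (x * y) = v x + v y) \<and>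
     (\<forall>x y. x \<noteq> 0 \<longrightarrow> y \<noteq> 0 \<longrightarrow> x + y \<noteq> 0 \<longrightarrow> min (v x) (v y) \<le> v (x + y)) \<and>
     (\<exists>x. x \<noteq> 0 \<and> v x = 1)"

text \<open>Krull domain (classical definition): R is the intersection of the valuation rings of a
  family of discrete valuations of its fraction field, with finite character.
  For Z[X] \<subseteq> R \<subseteq> Q[X] the fraction field of R is Q(X).\<close>
definition krull_domain :: "rat poly set \<Rightarrow> bool" where
  "krull_domain R \<longleftrightarrow>
     (\<exists>V. (\<forall>v\<in>V. discrete_valuation v) \<and>
          emb ` R = {x. x = 0 \<or> (\<forall>v\<in>V. 0 \<le> v x)} \<and>
          (\<forall>x. x \<noteq> 0 \<longrightarrow> finite {v\<in>V. v x \<noteq> 0}))"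

definition polynomial_krull_domain :: "rat poly set \<Rightarrow> bool" where
  "polynomial_krull_domain R \<longleftrightarrow> ZX \<subseteq> R \<and> krull_domain R"

definition ideal_in :: "rat poly set \<Rightarrow> rat poly set \<Rightarrow> bool" where
  "ideal_in R Q \<longleftrightarrow> Q \<subseteq> R \<and> 0 \<in> Q \<and> (\<forall>a\<in>Q. \<forall>b\<in>Q. a + b \<in> Q) \<and>
     (\<forall>r\<in>R. \<forall>a\<in>Q. r * a \<in> Q)"

definition prime_ideal_in :: "rat poly set \<Rightarrow> rat poly set \<Rightarrow> bool" where
  "prime_ideal_in R Q \<longleftrightarrow> ideal_in R Q \<and> Q \<noteq> R \<and>
     (\<forall>a\<in>R. \<forall>b\<in>R. a * b \<in> Q \<longrightarrow> a \<in> Q \<or> b \<in> Q)"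

definition maximal_ideal_in :: "rat poly set \<Rightarrow> rat poly set \<Rightarrow> bool" where
  "maximal_ideal_in R Q \<longleftrightarrow> ideal_in R Q \<and> Q \<noteq> R \<and>
     (\<forall>J. ideal_in R J \<and> Q \<subseteq> J \<longrightarrow> J = Q \<or> J = R)"

definition height_one_prime_in :: "rat poly set \<Rightarrow> rat poly set \<Rightarrow> bool" where
  "height_one_prime_in R Q \<longleftrightarrow> prime_ideal_in R Q \<and> Q \<noteq> {0} \<and>
     \<not> (\<exists>P. prime_ideal_in R P \<and> P \<noteq> {0} \<and> P \<subset> Q)"

definition pure :: "rat poly set \<Rightarrow> bool" where
  "pure R \<longleftrightarrow> (\<forall>Q. height_one_prime_in R Q \<and> (\<exists>n::int. n \<noteq> 0 \<and> [:of_int n:] \<in> Q)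
                   \<longrightarrow> \<not> maximal_ideal_in R Q)"

definition pure_polynomial_krull_domain :: "rat poly set \<Rightarrow> bool" where
  "pure_polynomial_krull_domain R \<longleftrightarrow> polynomial_krull_domain R \<and> pure R"

definition frac_ideal :: "rat poly set \<Rightarrow> qfun set \<Rightarrow> bool" where
  "frac_ideal R I \<longleftrightarrow> 0 \<in> I \<and> I \<noteq> {0} \<and> (\<forall>x\<in>I. \<forall>y\<in>I. x + y \<in> I) \<and>
     (\<forall>r\<in>R. \<forall>x\<in>I. emb r * x \<in> I) \<and>
     (\<exists>d\<in>R. d \<noteq> 0 \<and> (\<forall>x\<in>I. emb d * x \<in> emb ` R))"

definition colon :: "rat poly set \<Rightarrow> qfun set \<Rightarrow> qfun set" where
  "colon R I = {x. \<forall>y\<in>I. x * y \<in> emb ` R}"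

definition divisorial :: "rat poly set \<Rightarrow> qfun set \<Rightarrow> bool" where
  "divisorial R I \<longleftrightarrow> frac_ideal R I \<and> colon R (colon R I) = I"

text \<open>v-product (IJ)_v = ((IJ)^{-1})^{-1}; (IJ)^{-1} only depends on the products x*y.\<close>
definition vprod :: "rat poly set \<Rightarrow> qfun set \<Rightarrow> qfun set \<Rightarrow> qfun set" where
  "vprod R I J = colon R (colon R {x * y | x y. x \<in> I \<and> y \<in> J})"

definition divisor_group :: "rat poly set \<Rightarrow> qfun set monoid" where
  "divisor_group R = \<lparr>carrier = {I. divisorial R I}, monoid.mult = vprod R, one = emb ` R\<rparr>"

definition principal_ideals :: "rat poly set \<Rightarrow> qfun set set" where
  "principal_ideals R = {{x * emb r | r. r \<in> R} | x. x \<noteq> 0}"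

definition class_group :: "rat poly set \<Rightarrow> qfun set set monoid" where
  "class_group R = divisor_group R Mod principal_ideals R"

definition mult_subset_int :: "int set \<Rightarrow> bool" where
  "mult_subset_int S \<longleftrightarrow> 1 \<in> S \<and> 0 \<notin> S \<and> (\<forall>a\<in>S. \<forall>b\<in>S. a * b \<in> S)"

definition localize :: "rat poly set \<Rightarrow> int set \<Rightarrow> rat poly set" where
  "localize R S = {smult (1 / of_int s) f | f s. f \<in> R \<and> s \<in> S}"

definition finitely_generated_group :: "('a, 'b) monoid_scheme \<Rightarrow> bool" where
  "finitely_generated_group G \<longleftrightarrow>
     (\<exists>A. finite A \<and> A \<subseteq> carrier G \<and> generate G A = carrier G)"

end

theory Submission
  imports Defs "HOL-Computational_Algebra.Polynomial_Factorial"
    "HOL-Computational_Algebra.Field_as_Ring"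
begin

text \<open>
  Let \<open>R\<close> be an intersection of \<open>\<rat>[X]\<close> with valuation rings over primes \<open>p\<close>. Since \<open>\<rat>[X]\<close> is a
  principal ideal domain with units \<open>\<rat> - {0}\<close>, the class group of \<open>R\<close> is the free group on these
  valuations modulo the divisors of the primes, so the primes contribute independently. We use the
  valuations sending \<open>\<Sum> c\<^sub>i (X - t)\<^sup>i\<close> to \<open>min (e v\<^sub>p(c\<^sub>i) + i)\<close>, in which \<open>p\<close> has value \<open>e\<close>. One
  such valuation contributes \<open>\<int>/e\<close>; two with \<open>e = 1\<close> and centers distinct modulo \<open>p\<close> contribute
  \<open>\<int>\<^sup>2/(1,1)\<close>, which is infinite cyclic. As every finitely generated abelian group is a direct sum of
  cyclic groups, it remains to spend one prime on each cyclic summand. A nonzero polynomial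
  has nonzero value at only finitely many of the valuations if the prime attached to the center \<open>t\<close> exceeds
  \<open>t\<^sup>t\<close>. Inverting all integers prime to the primes used for \<open>G\<^sub>i\<close> leaves exactly the valuations
  belonging to \<open>G\<^sub>i\<close>. The residue fields are transcendental over the prime fields, and since the
  residue degree of polynomials is additive, the height-one primes over \<open>p\<close> are not maximal.
\<close>

section \<open>Monomial p-adic valuations\<close>

hide_const (open) Divisibility.prime

text \<open>The obstacle is independence of the valuations: one that was implied by the others would
  leave no trace in the divisorial ideals, and the divisor group would no longer be free on the
  family. Independence is obtained as an approximation property: a prescribed value is attained at
  one place while finitely supported lower bounds hold at all others. The elements are explicit. An
  element of Q(X) settles the orders at the irreducible polynomials, a power of p and powers of X -
  t settle the values over one prime, and an integer prime to p raises the values at the remaining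
  centers. This is why two centers over p must differ modulo p: X - t then has value 1 at its own
  center and 0 at the other. The second obstacle is finite character. With integral centers, a
  polynomial with integer coefficients has value 0 at t unless the attached prime divides f(t), and
  f(t) grows only polynomially in t, so fast growing primes suffice.\<close>

definition padic :: "int \<Rightarrow> rat \<Rightarrow> int" where
  "padic p x = int (multiplicity p (fst (quotient_of x))) - int (multiplicity p (snd (quotient_of x)))"

lemma padic_fraction:
  assumes "prime p" "a \<noteq> 0" "b \<noteq> 0"
  shows "padic p (of_int a / of_int b) = int (multiplicity p a) - int (multiplicity p b)"
proof -
  obtain c d where q: "quotient_of (of_int a / of_int b :: rat) = (c, d)"
    by (cases "quotient_of (of_int a / of_int b :: rat)") auto
  have d: "d > 0" using quotient_of_denom_pos[OF q] .
  have "(of_int a / of_int b :: rat) = of_int c / of_int d" using quotient_of_div[OF q] .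
  then have "(of_int (a * d) :: rat) = of_int (c * b)"
    using assms d by (simp add: field_simps)
  then have eq: "a * d = c * b" by (simp only: of_int_eq_iff)
  have c: "c \<noteq> 0" using eq assms d by auto
  have "multiplicity p a + multiplicity p d = multiplicity p c + multiplicity p b"
    using eq assms d c by (metis prime_elem_multiplicity_mult_distrib prime_imp_prime_elem less_irrefl)
  then show ?thesis by (simp add: padic_def q)
qed

lemma rat_fractionE:
  obtains a b :: int where "b \<noteq> 0" "(x::rat) = of_int a / of_int b"
  by (metis quotient_of_denom_pos quotient_of_div surj_pair less_irrefl)

lemma padic_of_int: "prime p \<Longrightarrow> a \<noteq> 0 \<Longrightarrow> padic p (of_int a) = int (multiplicity p a)"
  using padic_fraction[of p a 1] by simp

lemma padic_mult:
  assumes p: "prime p" and "x \<noteq> 0" "y \<noteq> 0"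
  shows "padic p (x * y) = padic p x + padic p y"
proof -
  obtain a b c d where x: "b \<noteq> 0" "x = of_int a / of_int b" and y: "d \<noteq> 0" "y = of_int c / of_int d"
    by (metis rat_fractionE)
  have nz: "a \<noteq> 0" "c \<noteq> 0" using assms x y by auto
  have "x * y = of_int (a * c) / of_int (b * d)" using x y by simp
  then have "padic p (x * y) = int (multiplicity p (a * c)) - int (multiplicity p (b * d))"
    using x y nz p by (simp only: padic_fraction mult_eq_0_iff simp_thms)
  then show ?thesis using x y nz p
    by (simp add: padic_fraction prime_elem_multiplicity_mult_distrib[OF prime_imp_prime_elem])
qed

lemma padic_add:
  assumes p: "prime p" and "x \<noteq> 0" "y \<noteq> 0" "x + y \<noteq> 0"
  shows "min (padic p x) (padic p y) \<le> padic p (x + y)"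
proof -
  obtain a b c d where x: "b \<noteq> 0" "x = of_int a / of_int b" and y: "d \<noteq> 0" "y = of_int c / of_int d"
    by (metis rat_fractionE)
  have x': "x = of_int (a * d) / of_int (b * d)" and y': "y = of_int (c * b) / of_int (b * d)"
    using x y by simp_all
  have xy: "x + y = of_int (a * d + c * b) / of_int (b * d)"
    using x y by (simp add: field_simps)
  have nz: "a * d \<noteq> 0" "c * b \<noteq> 0" "b * d \<noteq> 0" "a * d + c * b \<noteq> 0"
    using assms x y xy by (auto simp del: of_int_add of_int_mult)
  let ?m = "min (multiplicity p (a * d)) (multiplicity p (c * b))"
  have "p ^ ?m dvd a * d + c * b"
    by (intro dvd_add multiplicity_dvd') auto
  moreover have "\<not> is_unit p" using p by auto
  ultimately have "?m \<le> multiplicity p (a * d + c * b)"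
    using nz by (intro multiplicity_geI) auto
  then show ?thesis
    unfolding x' y' using nz xy p x' y' by (simp add: padic_fraction del: of_int_mult of_int_add)
qed

lemma padic_one [simp]: "prime p \<Longrightarrow> padic p 1 = 0"
  using padic_of_int[of p 1] by simp

lemma padic_self: "prime p \<Longrightarrow> padic p (of_int p) = 1"
  using padic_of_int[of p p] by auto

lemma padic_minus: "prime p \<Longrightarrow> x \<noteq> 0 \<Longrightarrow> padic p (- x) = padic p x"
proof -
  assume p: "prime p" and x: "x \<noteq> 0"
  have "padic p (-1) = 0" using padic_of_int[of p "-1"] p by (simp add: multiplicity_unit_right)
  then show ?thesis using padic_mult[OF p, of "-1" x] x by simp
qed

lemma padic_inverse: "prime p \<Longrightarrow> x \<noteq> 0 \<Longrightarrow> padic p (inverse x) = - padic p x"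
  using padic_mult[of p x "inverse x"] by simp

lemma padic_Ints: "prime p \<Longrightarrow> x \<in> \<int> \<Longrightarrow> x \<noteq> 0 \<Longrightarrow> 0 \<le> padic p x"
  by (auto elim!: Ints_cases simp: padic_of_int)

lemma padic_not_dvd: "prime p \<Longrightarrow> \<not> p dvd a \<Longrightarrow> padic p (of_int a) = 0"
  by (cases "a = 0") (auto simp: padic_of_int not_dvd_imp_multiplicity_0)

lemma padic_power_int: "prime p \<Longrightarrow> x \<noteq> 0 \<Longrightarrow> padic p (x powi k) = k * padic p x"
proof -
  assume p: "prime p" and x: "x \<noteq> 0"
  have nat: "padic p (y ^ n) = int n * padic p y" if "y \<noteq> 0" for y n
    using p that by (induction n) (auto simp: padic_mult algebra_simps)
  show ?thesis
    using p x by (cases "k \<ge> 0") (auto simp: power_int_def nat padic_inverse)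
qed

lemma padic_distinct_primes:
  assumes "prime p" "prime (q::int)" "p \<noteq> q"
  shows "padic p (of_int q) = 0"
  using assms primes_dvd_imp_eq padic_not_dvd by blast

text \<open>The value of 0 should be infinite, but \<open>padic\<close> returns an ordinary integer
  there, so each bound carries the alternative that the element vanishes. The factor
  \<open>e\<close> makes the bound applicable to weights directly.\<close>

lemma padic_sum_ge:
  assumes p: "prime p" and fin: "finite A"
    and "\<And>i. i \<in> A \<Longrightarrow> x i = 0 \<or> c \<le> int e * padic p (x i)"
  shows "sum x A = 0 \<or> c \<le> int e * padic p (sum x A)"
  using fin assms(3)
proof (induction A)
  case (insert i A)
  consider "x i = 0" | "sum x A = 0" | "x i + sum x A = 0" | "x i \<noteq> 0" "sum x A \<noteq> 0" "x i + sum x A \<noteq> 0"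
    by blast
  then show ?case
  proof cases
    case 4
    have "c \<le> int e * padic p (x i)" "c \<le> int e * padic p (sum x A)"
      using 4 insert by auto
    then have "c \<le> int e * min (padic p (x i)) (padic p (sum x A))"
      by (auto simp: min_def)
    also have "\<dots> \<le> int e * padic p (x i + sum x A)"
      by (intro mult_left_mono padic_add p 4) auto
    finally show ?thesis using insert by simp
  qed (use insert in auto)
qed auto

text \<open>Equality in the ultrametric inequality: writing x as (x + y) + (- y) bounds the value of
  the sum from above as well.\<close>

lemma padic_add_dominated:
  assumes p: "prime p" and x: "x \<noteq> 0" and y: "y = 0 \<or> int e * padic p x < int e * padic p y"
  shows "x + y \<noteq> 0 \<and> int e * padic p (x + y) = int e * padic p x"
proof (cases "y = 0")
  case False
  have neg: "padic p (- y) = padic p y" using padic_minus[OF p False] .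
  have nz: "x + y \<noteq> 0"
  proof
    assume "x + y = 0"
    then have "x = - y" by (simp add: eq_neg_iff_add_eq_0)
    then show False using neg y False by auto
  qed
  have less: "padic p x < padic p y" using y False by (simp add: mult_less_cancel_left)
  have "padic p x \<le> padic p (x + y)" using padic_add[OF p x False nz] less by simp
  moreover have "padic p (x + y) \<le> padic p x"
    using padic_add[OF p nz, of "- y"] less neg x False by simp
  ultimately show ?thesis using nz by simp
qed (use x in auto)

section \<open>Weights of coefficients, minimal weight and residue degree\<close>

definition wt :: "int \<Rightarrow> nat \<Rightarrow> rat poly \<Rightarrow> nat \<Rightarrow> int" where
  "wt p e f i = int e * padic p (coeff f i) + int i"

definition lead :: "int \<Rightarrow> nat \<Rightarrow> rat poly \<Rightarrow> int \<Rightarrow> nat \<Rightarrow> bool" where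
  "lead p e f m D \<longleftrightarrow> coeff f D \<noteq> 0 \<and> wt p e f D = m \<and>
     (\<forall>i. coeff f i \<noteq> 0 \<longrightarrow> m \<le> wt p e f i) \<and> (\<forall>i>D. coeff f i \<noteq> 0 \<longrightarrow> m < wt p e f i)"

lemma lead_exists:
  assumes "f \<noteq> 0"
  shows "\<exists>m D. lead p e f m D"
proof -
  define S where "S = {i. coeff f i \<noteq> 0}"
  have fin: "finite S" unfolding S_def
    by (rule finite_subset[of _ "{..degree f}"]) (auto simp: le_degree)
  have "degree f \<in> S" using assms by (simp add: S_def)
  then have ne: "S \<noteq> {}" by auto
  define m where "m = Min (wt p e f ` S)"
  have "m \<in> wt p e f ` S" unfolding m_def using fin ne by (intro Min_in) auto
  then have ne': "{i \<in> S. wt p e f i = m} \<noteq> {}" by auto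
  define D where "D = Max {i \<in> S. wt p e f i = m}"
  have D: "D \<in> {i \<in> S. wt p e f i = m}" unfolding D_def using fin ne' by (intro Max_in) auto
  have m: "m \<le> wt p e f i" if "i \<in> S" for i using that fin by (auto simp: m_def)
  have "i \<le> D" if "i \<in> S" "wt p e f i = m" for i using that fin by (auto simp: D_def)
  then have "lead p e f m D" unfolding lead_def using D m
    by (force simp: S_def order.strict_iff_order)
  then show ?thesis by blast
qed

lemma lead_unique:
  assumes "lead p e f m D" "lead p e f m' D'"
  shows "m = m'" "D = D'"
proof -
  show m: "m = m'" using assms unfolding lead_def by (metis order.antisym)
  show "D = D'" using assms m unfolding lead_def by (metis linorder_neqE_nat less_irrefl)
qed

text \<open>The last index attaining the minimal weight is additive too: it is the degree of the
  residue class in the (transcendental) residue field extension.\<close>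

lemma lead_mult:
  assumes p: "prime p" and f: "lead p e f m D" and g: "lead p e g m' D'"
  shows "lead p e (f * g) (m + m') (D + D')"
proof -
  have term_wt: "int e * padic p (coeff f i * coeff g j) = wt p e f i + wt p e g j - int (i + j)"
    if "coeff f i \<noteq> 0" "coeff g j \<noteq> 0" for i j
    using that p by (simp add: padic_mult wt_def algebra_simps)
  have fD: "coeff f D \<noteq> 0" "wt p e f D = m" and gD: "coeff g D' \<noteq> 0" "wt p e g D' = m'"
    using f g by (auto simp: lead_def)
  have ge: "m \<le> wt p e f i" if "coeff f i \<noteq> 0" for i using f that by (auto simp: lead_def)
  have ge': "m' \<le> wt p e g i" if "coeff g i \<noteq> 0" for i using g that by (auto simp: lead_def)
  have gt: "m < wt p e f i" if "coeff f i \<noteq> 0" "i > D" for i using f that by (auto simp: lead_def)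
  have gt': "m' < wt p e g i" if "coeff g i \<noteq> 0" "i > D'" for i using g that by (auto simp: lead_def)
  have low: "coeff f i * coeff g j = 0 \<or> m + m' - int (i + j) \<le> int e * padic p (coeff f i * coeff g j)"
    for i j
    using term_wt[of i j] ge[of i] ge'[of j] by (cases "coeff f i = 0 \<or> coeff g j = 0") auto
  have high: "coeff f i * coeff g j = 0 \<or> m + m' - int (i + j) + 1 \<le> int e * padic p (coeff f i * coeff g j)"
    if "i > D \<or> j > D'" for i j
    using that term_wt[of i j] ge[of i] ge'[of j] gt[of i] gt'[of j]
    by (cases "coeff f i = 0 \<or> coeff g j = 0") auto
  let ?h = "\<lambda>n i. coeff f i * coeff g (n - i)"
  have all: "coeff (f * g) n = 0 \<or> m + m' - int n \<le> int e * padic p (coeff (f * g) n)" for n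
    unfolding coeff_mult
  proof (rule padic_sum_ge[OF p finite_atMost])
    fix i assume "i \<in> {..n}"
    then show "?h n i = 0 \<or> m + m' - int n \<le> int e * padic p (?h n i)"
      using low[of i "n - i"] by simp
  qed
  have above: "coeff (f * g) n = 0 \<or> m + m' - int n + 1 \<le> int e * padic p (coeff (f * g) n)"
    if "n > D + D'" for n
    unfolding coeff_mult
  proof (rule padic_sum_ge[OF p finite_atMost])
    fix i assume "i \<in> {..n}"
    then show "?h n i = 0 \<or> m + m' - int n + 1 \<le> int e * padic p (?h n i)"
      using high[of i "n - i"] that by (cases "i > D") auto
  qed
  let ?n = "D + D'"
  let ?x = "?h ?n D" and ?y = "sum (?h ?n) ({..?n} - {D})"
  have eq: "coeff (f * g) ?n = ?x + ?y"
    unfolding coeff_mult by (subst sum.remove[of _ D]) auto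
  \<comment> \<open>If i differs from D and i + j = D + D', then i > D or j > D'. So every other
    term is strictly larger than \<open>?x\<close>, and \<open>?x\<close> decides the value of the
    coefficient.\<close>
  have y: "?y = 0 \<or> m + m' - int ?n + 1 \<le> int e * padic p ?y"
  proof (rule padic_sum_ge[OF p])
    fix i assume "i \<in> {..?n} - {D}"
    then show "?h ?n i = 0 \<or> m + m' - int ?n + 1 \<le> int e * padic p (?h ?n i)"
      using high[of i "?n - i"] by (auto simp: linorder_neq_iff)
  qed auto
  have x: "?x \<noteq> 0" "int e * padic p ?x = m + m' - int ?n"
    using fD gD term_wt[of D D'] by auto
  have "?x + ?y \<noteq> 0 \<and> int e * padic p (?x + ?y) = int e * padic p ?x"
    using x y by (intro padic_add_dominated p) auto
  then have "coeff (f * g) ?n \<noteq> 0 \<and> wt p e (f * g) ?n = m + m'"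
    using x unfolding eq wt_def by linarith
  then show ?thesis unfolding lead_def wt_def using all above by (smt (verit))
qed

text \<open>The coefficients of f(X + a) are those of the expansion of f in powers of X - a. At the
  zero polynomial the value is unspecified.\<close>

definition monval :: "int \<Rightarrow> nat \<Rightarrow> nat \<Rightarrow> rat poly \<Rightarrow> int" where
  "monval p e a f = (THE m. \<exists>D. lead p e (f \<circ>\<^sub>p [:of_nat a, 1:]) m D)"

definition resdeg :: "int \<Rightarrow> nat \<Rightarrow> nat \<Rightarrow> rat poly \<Rightarrow> nat" where
  "resdeg p e a f = (THE D. \<exists>m. lead p e (f \<circ>\<^sub>p [:of_nat a, 1:]) m D)"

lemma shift_eq_0_iff [simp]: "f \<circ>\<^sub>p [:c, 1:] = 0 \<longleftrightarrow> (f :: rat poly) = 0"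
  by (simp add: pcompose_eq_0_iff)

lemma lead_shift:
  assumes "f \<noteq> 0"
  shows "lead p e (f \<circ>\<^sub>p [:of_nat a, 1:]) (monval p e a f) (resdeg p e a f)"
proof -
  obtain m D where mD: "lead p e (f \<circ>\<^sub>p [:of_nat a, 1:]) m D"
    using lead_exists[of "f \<circ>\<^sub>p [:of_nat a, 1:]" p e] assms by auto
  have "monval p e a f = m" unfolding monval_def
    by (rule the_equality) (use mD lead_unique in blast)+
  moreover have "resdeg p e a f = D" unfolding resdeg_def
    by (rule the_equality) (use mD lead_unique in blast)+
  ultimately show ?thesis using mD by simp
qed

lemma monval_resdeg_eqI:
  assumes "lead p e (f \<circ>\<^sub>p [:of_nat a, 1:]) m D"
  shows "monval p e a f = m" "resdeg p e a f = D"
proof -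
  have "f \<noteq> 0" using assms by (auto simp: lead_def)
  from lead_unique[OF lead_shift[OF this] assms]
  show "monval p e a f = m" "resdeg p e a f = D" .
qed

lemma monval_mult:
  assumes "prime p" "f \<noteq> 0" "g \<noteq> 0"
  shows "monval p e a (f * g) = monval p e a f + monval p e a g"
    and "resdeg p e a (f * g) = resdeg p e a f + resdeg p e a g"
proof -
  have "lead p e ((f * g) \<circ>\<^sub>p [:of_nat a, 1:]) (monval p e a f + monval p e a g) (resdeg p e a f + resdeg p e a g)"
    unfolding pcompose_mult using assms by (intro lead_mult lead_shift)
  from monval_resdeg_eqI[OF this]
  show "monval p e a (f * g) = monval p e a f + monval p e a g"
    "resdeg p e a (f * g) = resdeg p e a f + resdeg p e a g" .
qed

lemma monval_le:
  assumes "f \<noteq> 0" "coeff (f \<circ>\<^sub>p [:of_nat a, 1:]) i \<noteq> 0"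
  shows "monval p e a f \<le> wt p e (f \<circ>\<^sub>p [:of_nat a, 1:]) i"
  using lead_shift[OF assms(1), of p e a] assms(2) by (auto simp: lead_def)

lemma monval_geI:
  assumes "f \<noteq> 0"
    and "\<And>i. coeff (f \<circ>\<^sub>p [:of_nat a, 1:]) i \<noteq> 0 \<Longrightarrow> m \<le> wt p e (f \<circ>\<^sub>p [:of_nat a, 1:]) i"
  shows "m \<le> monval p e a f"
  using lead_shift[OF assms(1), of p e a] assms(2)[of "resdeg p e a f"] by (auto simp: lead_def)

lemma monval_add:
  assumes p: "prime p" and "f \<noteq> 0" "g \<noteq> 0" "f + g \<noteq> 0"
  shows "min (monval p e a f) (monval p e a g) \<le> monval p e a (f + g)"
proof (rule monval_geI)
  fix i
  let ?s = "[:of_nat a, 1:] :: rat poly"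
  assume nz: "coeff ((f + g) \<circ>\<^sub>p ?s) i \<noteq> 0"
  let ?m = "min (monval p e a f) (monval p e a g)"
  \<comment> \<open>A sum over the two-element type \<open>bool\<close> lets
    \<open>padic_sum_ge\<close> absorb the cases in which one of the coefficients is 0.\<close>
  let ?x = "\<lambda>b. if b then coeff (f \<circ>\<^sub>p ?s) i else coeff (g \<circ>\<^sub>p ?s) i"
  have "sum ?x UNIV = 0 \<or> ?m - int i \<le> int e * padic p (sum ?x UNIV)"
  proof (rule padic_sum_ge[OF p])
    fix b :: bool
    show "?x b = 0 \<or> ?m - int i \<le> int e * padic p (?x b)"
      using monval_le[OF assms(2), of a i p e] monval_le[OF assms(3), of a i p e] by (auto simp: wt_def)
  qed auto
  moreover have "sum ?x UNIV = coeff ((f + g) \<circ>\<^sub>p ?s) i"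
    by (simp add: UNIV_bool pcompose_add)
  ultimately show "?m \<le> wt p e ((f + g) \<circ>\<^sub>p ?s) i" using nz by (auto simp: wt_def)
qed fact

lemma monval_const:
  assumes "c \<noteq> 0"
  shows "monval p e a [:c:] = int e * padic p c" "resdeg p e a [:c:] = 0"
proof -
  have "lead p e ([:c:] \<circ>\<^sub>p [:of_nat a, 1:]) (int e * padic p c) 0"
    using assms by (auto simp: lead_def wt_def pcompose_const coeff_pCons split: nat.splits)
  from monval_resdeg_eqI[OF this]
  show "monval p e a [:c:] = int e * padic p c" "resdeg p e a [:c:] = 0" .
qed

lemma monval_smult:
  assumes "prime p" "c \<noteq> 0" "f \<noteq> 0"
  shows "monval p e a (smult c f) = int e * padic p c + monval p e a f"
  using monval_mult(1)[OF assms(1), of "[:c:]" f e a] assms by (simp add: monval_const)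

lemma monval_center:
  assumes "prime p"
  shows "monval p e a [:- of_nat a, 1:] = 1" "resdeg p e a [:- of_nat a, 1:] = 1"
proof -
  have eq: "[:- of_nat a, 1:] \<circ>\<^sub>p [:of_nat a, 1:] = ([:0, 1:] :: rat poly)"
    by (simp add: pcompose_pCons)
  have "lead p e ([:- of_nat a, 1:] \<circ>\<^sub>p [:of_nat a, 1:]) 1 1"
    unfolding eq using assms by (auto simp: lead_def wt_def coeff_pCons split: nat.splits if_splits)
  from monval_resdeg_eqI[OF this]
  show "monval p e a [:- of_nat a, 1:] = 1" "resdeg p e a [:- of_nat a, 1:] = 1" .
qed

section \<open>Values of polynomials with integer coefficients\<close>

lemma ZX_add: "f \<in> ZX \<Longrightarrow> g \<in> ZX \<Longrightarrow> f + g \<in> ZX"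
  by (auto simp: ZX_def)

lemma ZX_mult: "f \<in> ZX \<Longrightarrow> g \<in> ZX \<Longrightarrow> f * g \<in> ZX"
  by (auto simp: ZX_def coeff_mult)

lemma ZX_const: "c \<in> \<int> \<Longrightarrow> [:c:] \<in> ZX"
  by (auto simp: ZX_def coeff_pCons split: nat.splits)

lemma ZX_linear: "c \<in> \<int> \<Longrightarrow> [:c, 1:] \<in> ZX"
  by (auto simp: ZX_def coeff_pCons split: nat.splits)

lemma ZX_pcompose:
  assumes g: "g \<in> ZX"
  shows "f \<in> ZX \<Longrightarrow> f \<circ>\<^sub>p g \<in> ZX"
proof (induction f)
  case (pCons a f)
  have "coeff (pCons a f) 0 \<in> \<int>" "\<And>i. coeff (pCons a f) (Suc i) \<in> \<int>"
    using pCons.prems unfolding ZX_def by blast+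
  then have "a \<in> \<int>" "f \<in> ZX" by (auto simp: ZX_def)
  then show ?case using pCons.IH by (simp add: pcompose_pCons ZX_add ZX_mult ZX_const g)
qed auto

lemma monval_ZX_ge_0:
  assumes p: "prime p" and f: "f \<in> ZX" "f \<noteq> 0"
  shows "0 \<le> monval p e a f"
proof (rule monval_geI[OF f(2)])
  fix i assume nz: "coeff (f \<circ>\<^sub>p [:of_nat a, 1:]) i \<noteq> 0"
  have "f \<circ>\<^sub>p [:of_nat a, 1:] \<in> ZX" using f by (intro ZX_pcompose ZX_linear) auto
  then have "0 \<le> padic p (coeff (f \<circ>\<^sub>p [:of_nat a, 1:]) i)"
    using nz p by (intro padic_Ints) (auto simp: ZX_def)
  then show "0 \<le> wt p e (f \<circ>\<^sub>p [:of_nat a, 1:]) i" by (simp add: wt_def)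
qed

text \<open>The constant term of the expansion at a is f(a); if p does not divide it, its weight is
  0, the least that an integral polynomial admits. Finite character and the separation of two
  centers over one prime both rest on this.\<close>

lemma monval_ZX_eq_0:
  assumes p: "prime p" and f: "f \<in> ZX" "f \<noteq> 0" and a: "poly f (of_nat a) = of_int b" "\<not> p dvd b"
  shows "monval p e a f = 0"
proof -
  have c: "coeff (f \<circ>\<^sub>p [:of_nat a, 1:]) 0 = of_int b" using a by (simp add: coeff_pcompose_0)
  moreover have "b \<noteq> 0" using a by auto
  ultimately have "monval p e a f \<le> wt p e (f \<circ>\<^sub>p [:of_nat a, 1:]) 0"
    by (intro monval_le f) auto
  also have "\<dots> = 0" using c p a by (simp add: wt_def padic_not_dvd)
  finally show ?thesis using monval_ZX_ge_0[OF p f, of e a] by simp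
qed

text \<open>Such an element reduces to 1 in the residue field: its constant coefficient keeps weight
  0 and all others have positive weight. It will be compared with multiples of an element of
  positive residue degree.\<close>

lemma resdeg_one_minus:
  assumes p: "prime p" and h: "h = 0 \<or> 0 < monval p e a h" 
  shows "1 - h \<noteq> 0" "monval p e a (1 - h) = 0" "resdeg p e a (1 - h) = 0"
proof -
  let ?s = "[:of_nat a, 1:] :: rat poly"
  have s: "(1 - h) \<circ>\<^sub>p ?s = 1 - h \<circ>\<^sub>p ?s" by (simp add: pcompose_diff one_pCons)
  have wt: "0 < wt p e (h \<circ>\<^sub>p ?s) i" if "coeff (h \<circ>\<^sub>p ?s) i \<noteq> 0" for i
    using h monval_le[of h a i p e] that by force
  have 0: "coeff (1 - h \<circ>\<^sub>p ?s) 0 \<noteq> 0 \<and> int e * padic p (coeff (1 - h \<circ>\<^sub>p ?s) 0) = 0"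
    using padic_add_dominated[OF p, of 1 "- coeff (h \<circ>\<^sub>p ?s) 0" e] wt[of 0] p
    by (cases "coeff (h \<circ>\<^sub>p ?s) 0 = 0") (auto simp: wt_def padic_minus)
  have pos: "0 < wt p e (1 - h \<circ>\<^sub>p ?s) i" if "i > 0" "coeff (1 - h \<circ>\<^sub>p ?s) i \<noteq> 0" for i
    using that wt[of i] p by (auto simp: wt_def padic_minus)
  have "0 \<le> wt p e (1 - h \<circ>\<^sub>p ?s) i" if "coeff (1 - h \<circ>\<^sub>p ?s) i \<noteq> 0" for i
    using pos[of i] that 0 by (cases "i = 0") (auto simp: wt_def)
  then have "lead p e ((1 - h) \<circ>\<^sub>p ?s) 0 0" unfolding s lead_def
    using 0 pos by (auto simp: wt_def)
  from monval_resdeg_eqI[OF this] this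
  show "1 - h \<noteq> 0" "monval p e a (1 - h) = 0" "resdeg p e a (1 - h) = 0"
    by (auto simp: lead_def)
qed

section \<open>Valuations of the rational function field\<close>

text \<open>Formulated for integral domains and without normalization, so that one notion serves the
  polynomials and their field of fractions.\<close>

definition valuation :: "('a::idom \<Rightarrow> int) \<Rightarrow> bool" where
  "valuation v \<longleftrightarrow> (\<forall>x y. x \<noteq> 0 \<longrightarrow> y \<noteq> 0 \<longrightarrow> v (x * y) = v x + v y) \<and>
     (\<forall>x y. x \<noteq> 0 \<longrightarrow> y \<noteq> 0 \<longrightarrow> x + y \<noteq> 0 \<longrightarrow> min (v x) (v y) \<le> v (x + y))"

lemma valuation_mult: "valuation v \<Longrightarrow> x \<noteq> 0 \<Longrightarrow> y \<noteq> 0 \<Longrightarrow> v (x * y) = v x + v y"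
  by (simp add: valuation_def)

lemma valuation_add: "valuation v \<Longrightarrow> x \<noteq> 0 \<Longrightarrow> y \<noteq> 0 \<Longrightarrow> x + y \<noteq> 0 \<Longrightarrow> min (v x) (v y) \<le> v (x + y)"
  by (simp add: valuation_def)

lemma valuation_one: "valuation v \<Longrightarrow> v 1 = 0"
  using valuation_mult[of v 1 1] by simp

lemma valuation_inverse: "valuation v \<Longrightarrow> (x :: 'a :: field) \<noteq> 0 \<Longrightarrow> v (inverse x) = - v x"
  using valuation_mult[of v x "inverse x"] by (simp add: valuation_one)

lemma valuation_divide: "valuation v \<Longrightarrow> (x :: 'a :: field) \<noteq> 0 \<Longrightarrow> y \<noteq> 0 \<Longrightarrow> v (x / y) = v x - v y"
  by (simp add: divide_inverse valuation_mult valuation_inverse)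

lemma valuation_power: "valuation v \<Longrightarrow> x \<noteq> 0 \<Longrightarrow> v (x ^ n) = int n * v x"
  by (induction n) (auto simp: valuation_one valuation_mult algebra_simps)

lemma valuation_power_int: "valuation v \<Longrightarrow> (x :: 'a :: field) \<noteq> 0 \<Longrightarrow> v (x powi n) = n * v x"
  by (auto simp: power_int_def valuation_power valuation_inverse)

lemma discrete_valuation_iff: "discrete_valuation v \<longleftrightarrow> valuation v \<and> (\<exists>x. x \<noteq> 0 \<and> v x = 1)"
  by (auto simp: discrete_valuation_def valuation_def)

lemma emb_mult: "emb (f * g) = emb f * emb g"
  by (simp add: emb_def)

lemma emb_add: "emb (f + g) = emb f + emb g"
  by (simp add: emb_def)

lemma emb_eq_iff [simp]: "emb f = emb g \<longleftrightarrow> f = g"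
  by (simp add: emb_def eq_fract)

lemma emb_0 [simp]: "emb 0 = 0"
  by (simp add: emb_def Zero_fract_def)

lemma emb_1 [simp]: "emb 1 = 1"
  by (simp add: emb_def One_fract_def)

lemma emb_eq_0_iff [simp]: "emb f = 0 \<longleftrightarrow> f = 0"
  using emb_eq_iff[of f 0] by (simp del: emb_eq_iff)

lemma emb_eq_1_iff [simp]: "emb f = 1 \<longleftrightarrow> f = 1"
  using emb_eq_iff[of f 1] by (simp del: emb_eq_iff)

lemma Fract_eq_emb: "b \<noteq> 0 \<Longrightarrow> Fraction_Field.Fract a b = emb a / emb b"
  by (simp add: emb_def divide_fract)

lemma qfun_fractionE:
  obtains a b where "b \<noteq> 0" "x = emb a / emb b"
  by (metis Fract_cases Fract_eq_emb)

definition fract_val :: "(rat poly \<Rightarrow> int) \<Rightarrow> qfun \<Rightarrow> int" where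
  "fract_val v x = (SOME k. \<exists>a b. a \<noteq> 0 \<and> b \<noteq> 0 \<and> x = emb a / emb b \<and> k = v a - v b)"

lemma fract_val_divide:
  assumes "valuation v" "a \<noteq> 0" "b \<noteq> 0"
  shows "fract_val v (emb a / emb b) = v a - v b"
  unfolding fract_val_def
proof (rule some_equality)
  show "\<exists>a' b'. a' \<noteq> 0 \<and> b' \<noteq> 0 \<and> emb a / emb b = emb a' / emb b' \<and> v a - v b = v a' - v b'"
    using assms by blast
next
  fix k assume "\<exists>a' b'. a' \<noteq> 0 \<and> b' \<noteq> 0 \<and> emb a / emb b = emb a' / emb b' \<and> k = v a' - v b'"
  then obtain c d where cd: "c \<noteq> 0" "d \<noteq> 0" "emb a / emb b = emb c / emb d" "k = v c - v d"
    by blast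
  then have "emb (a * d) = emb (c * b)" using assms by (simp add: emb_mult frac_eq_eq)
  then have "a * d = c * b" by (simp only: emb_eq_iff)
  then have "v a + v d = v c + v b" using assms cd by (metis valuation_mult)
  then show "k = v a - v b" using cd by simp
qed

lemma fract_val_emb: "valuation v \<Longrightarrow> a \<noteq> 0 \<Longrightarrow> fract_val v (emb a) = v a"
  using fract_val_divide[of v a 1] by (simp add: valuation_one)

lemma valuation_fract_val:
  assumes v: "valuation v"
  shows "valuation (fract_val v)"
  unfolding valuation_def
proof (intro conjI allI impI)
  fix x y :: qfun assume nz: "x \<noteq> 0" "y \<noteq> 0"
  obtain a b c d where b: "b \<noteq> 0" "x = emb a / emb b" and d: "d \<noteq> 0" "y = emb c / emb d"
    by (metis qfun_fractionE)
  have a: "a \<noteq> 0" "c \<noteq> 0" using nz b d by auto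
  have "x * y = emb (a * c) / emb (b * d)" using b d by (simp add: emb_mult)
  then show "fract_val v (x * y) = fract_val v x + fract_val v y"
    using a b d v by (simp only: fract_val_divide mult_eq_0_iff simp_thms valuation_mult)
  assume xy: "x + y \<noteq> 0"
  have 1: "x = emb (a * d) / emb (b * d)" "y = emb (c * b) / emb (b * d)"
    using b d by (simp_all add: emb_mult)
  have 2: "x + y = emb (a * d + c * b) / emb (b * d)"
    using b d by (simp add: emb_mult emb_add field_simps)
  then have 3: "a * d + c * b \<noteq> 0" using xy by auto
  have nz: "a * d \<noteq> 0" "c * b \<noteq> 0" "b * d \<noteq> 0" using a b d by auto
  have "min (v (a * d)) (v (c * b)) \<le> v (a * d + c * b)"
    by (intro valuation_add v 3 nz)
  then show "min (fract_val v x) (fract_val v y) \<le> fract_val v (x + y)"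
    unfolding 2 unfolding 1 fract_val_divide[OF v nz(1,3)] fract_val_divide[OF v nz(2,3)]
      fract_val_divide[OF v 3 nz(3)] by simp
qed

lemma discrete_valuation_fract_val:
  "valuation v \<Longrightarrow> f \<noteq> 0 \<Longrightarrow> v f = 1 \<Longrightarrow> discrete_valuation (fract_val v)"
  unfolding discrete_valuation_iff using valuation_fract_val[of v] fract_val_emb[of v f]
  by (metis emb_eq_0_iff)

lemma valuation_monval: "prime p \<Longrightarrow> valuation (monval p e a)"
  by (simp add: valuation_def monval_mult monval_add)

section \<open>Orders at the irreducible polynomials\<close>

definition pord :: "rat poly \<Rightarrow> rat poly \<Rightarrow> int" where
  "pord q f = int (multiplicity q f)"

lemma valuation_pord:
  assumes "prime q"
  shows "valuation (pord q)"
  unfolding valuation_def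
proof (intro conjI allI impI)
  fix f g :: "rat poly" assume nz: "f \<noteq> 0" "g \<noteq> 0"
  then show "pord q (f * g) = pord q f + pord q g"
    using assms by (simp add: pord_def prime_elem_multiplicity_mult_distrib[OF prime_imp_prime_elem])
  assume "f + g \<noteq> 0"
  moreover have "q ^ min (multiplicity q f) (multiplicity q g) dvd f + g"
    by (intro dvd_add multiplicity_dvd') auto
  moreover have "\<not> is_unit q" using assms by auto
  ultimately have "min (multiplicity q f) (multiplicity q g) \<le> multiplicity q (f + g)"
    by (intro multiplicity_geI) auto
  then show "min (pord q f) (pord q g) \<le> pord q (f + g)"
    by (simp add: pord_def)
qed

text \<open>Being \<open>prime\<close> includes being normalized, that is monic, so distinct primes
  are not associated.\<close>

lemma pord_prime: "prime q \<Longrightarrow> prime r \<Longrightarrow> pord q r = (if q = r then 1 else 0)"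
  by (auto simp: pord_def prime_multiplicity_other multiplicity_prime[OF prime_imp_prime_elem])

lemma pord_unit: "is_unit f \<Longrightarrow> pord q f = 0"
  by (simp add: pord_def multiplicity_unit_right)

abbreviation ordq :: "rat poly \<Rightarrow> qfun \<Rightarrow> int" where
  "ordq q \<equiv> fract_val (pord q)"

lemma valuation_ordq: "prime q \<Longrightarrow> valuation (ordq q)"
  by (simp add: valuation_fract_val valuation_pord)

lemma finite_ordq_nonzero:
  assumes "x \<noteq> 0"
  shows "finite {q. prime q \<and> ordq q x \<noteq> 0}"
proof -
  obtain a b where b: "b \<noteq> 0" and x: "x = emb a / emb b" by (metis qfun_fractionE)
  have a: "a \<noteq> 0" using assms x by auto
  have "{q. prime q \<and> ordq q x \<noteq> 0} \<subseteq> prime_factors a \<union> prime_factors b"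
    using a b x by (auto simp: fract_val_divide valuation_pord pord_def prime_factors_multiplicity)
  then show ?thesis by (rule finite_subset) auto
qed

lemma ordq_nonneg_imp_emb:
  assumes "\<And>q. prime q \<Longrightarrow> 0 \<le> ordq q x" "x \<noteq> 0"
  shows "\<exists>f. x = emb f"
proof -
  obtain a b where b: "b \<noteq> 0" and x: "x = emb a / emb b" by (metis qfun_fractionE)
  have a: "a \<noteq> 0" using assms x by auto
  have "multiplicity q b \<le> multiplicity q a" if "prime q" for q
    using assms(1)[OF that] a b x that by (simp add: fract_val_divide valuation_pord pord_def)
  then have "b dvd a" by (intro multiplicity_le_imp_dvd b)
  then obtain f where "a = b * f" by auto
  then show ?thesis using x b by (auto simp: emb_mult)
qed

text \<open>Both x and its inverse are polynomials, so x is a unit of Q[X]. This is what reduces the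
  principal divisors supported at the centers to the divisors of rational numbers.\<close>

lemma ordq_eq_0_imp_const:
  assumes "\<And>q. prime q \<Longrightarrow> ordq q x = 0" "x \<noteq> 0"
  shows "\<exists>c. c \<noteq> 0 \<and> x = emb [:c:]"
proof -
  obtain f where f: "x = emb f" using ordq_nonneg_imp_emb[of x] assms by auto
  have "0 \<le> ordq q (inverse x)" if "prime q" for q
    using assms that by (simp add: valuation_inverse valuation_ordq)
  then obtain g where g: "inverse x = emb g" using ordq_nonneg_imp_emb[of "inverse x"] assms by auto
  have "emb (f * g) = 1" using f g assms by (simp add: emb_mult flip: f g)
  then have "f * g = 1" by simp
  then have "is_unit f" by (metis dvd_triv_left)
  then obtain c where "f = [:c:]" by (auto simp: is_unit_poly_iff)
  moreover from this have "c \<noteq> 0" using f assms by auto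
  ultimately show ?thesis using f by auto
qed

text \<open>The class group of Q[X] is trivial: a product of prime powers with integer exponents
  does it. With this every divisor can be moved to the centers.\<close>

lemma exists_ordq_eq:
  fixes D :: "rat poly \<Rightarrow> int"
  assumes "finite {q. prime q \<and> D q \<noteq> 0}"
  shows "\<exists>x. x \<noteq> 0 \<and> (\<forall>q. prime q \<longrightarrow> ordq q x = D q)"
proof -
  have "\<exists>x. x \<noteq> 0 \<and> (\<forall>q. prime q \<longrightarrow> ordq q x = (if q \<in> A then D q else 0))"
    if "finite A" "\<forall>q\<in>A. prime q" for A
    using that
  proof (induction A)
    case empty
    then show ?case by (intro exI[of _ 1]) (auto simp: valuation_one valuation_ordq)
  next
    case (insert r A)
    then obtain x where x: "x \<noteq> 0" "\<And>q. prime q \<Longrightarrow> ordq q x = (if q \<in> A then D q else 0)"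
      by auto
    have r: "prime r" "r \<noteq> 0" using insert by auto
    have "ordq q (x * emb r powi D r) = (if q \<in> insert r A then D q else 0)" if q: "prime q" for q
      using x r q insert.hyps
      by (simp add: valuation_mult valuation_ordq valuation_power_int fract_val_emb valuation_pord pord_prime)
    moreover have "x * emb r powi D r \<noteq> 0" using x r by simp
    ultimately show ?case by blast
  qed
  from this[OF assms] show ?thesis by auto
qed

section \<open>Class groups of Krull domains\<close>

lemma int_Inf_in:
  assumes "(S :: int set) \<noteq> {}" "bdd_below S"
  shows "Inf S \<in> S"
proof -
  obtain x where x: "x \<in> S" "x < Inf S + 1" using cInf_lessD[OF assms(1), of "Inf S + 1"] by auto
  moreover have "Inf S \<le> x" using x assms by (intro cInf_lower)
  ultimately show ?thesis by (metis order.antisym zless_add1_eq order_less_le)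
qed

text \<open>The last assumption makes every valuation of the family essential: each lower bound of a
  divisor is attained at each index, so different divisors define different ideals. Valuations are
  indexed by \<open>J\<close>, so that a divisor is an integer function on the indices; its values
  outside \<open>J\<close> are arbitrary.\<close>

locale krull_family =
  fixes R :: "rat poly set" and J :: "'j set" and val :: "'j \<Rightarrow> qfun \<Rightarrow> int"
  assumes val: "j \<in> J \<Longrightarrow> valuation (val j)"
    and emb_R: "emb ` R = {x. x = 0 \<or> (\<forall>j\<in>J. 0 \<le> val j x)}"
    and finite_character: "x \<noteq> 0 \<Longrightarrow> finite {j \<in> J. val j x \<noteq> 0}"
    and J_nonempty: "J \<noteq> {}"
    and approximation: "finite {j \<in> J. D j \<noteq> 0} \<Longrightarrow> i \<in> J \<Longrightarrow>
      \<exists>x. x \<noteq> 0 \<and> val i x = D i \<and> (\<forall>j\<in>J. D j \<le> val j x)"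
begin

definition divisor :: "('j \<Rightarrow> int) \<Rightarrow> bool" where
  "divisor D \<longleftrightarrow> finite {j \<in> J. D j \<noteq> 0}"

definition ideal_of :: "('j \<Rightarrow> int) \<Rightarrow> qfun set" where
  "ideal_of D = {x. x = 0 \<or> (\<forall>j\<in>J. D j \<le> val j x)}"

definition content :: "qfun set \<Rightarrow> 'j \<Rightarrow> int" where
  "content A j = Inf {val j x | x. x \<in> A \<and> x \<noteq> 0}"

text \<open>Weaker than \<open>frac_ideal\<close>: no closure properties are required, so that the
  bare set of products inside \<open>vprod\<close> qualifies.\<close>

definition fractional :: "qfun set \<Rightarrow> bool" where
  "fractional A \<longleftrightarrow> (\<exists>x\<in>A. x \<noteq> 0) \<and> (\<exists>d. d \<noteq> 0 \<and> (\<forall>x\<in>A. d * x \<in> emb ` R))"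

lemma in_R_iff: "x \<in> emb ` R \<longleftrightarrow> x = 0 \<or> (\<forall>j\<in>J. 0 \<le> val j x)"
  by (simp add: emb_R)

lemma R_eq_ideal_of: "emb ` R = ideal_of (\<lambda>j. 0)"
  by (simp add: emb_R ideal_of_def)

lemma divisor_uminus: "divisor D \<Longrightarrow> divisor (\<lambda>j. - D j)"
  by (simp add: divisor_def)

lemma divisor_zero: "divisor (\<lambda>j. 0)"
  by (simp add: divisor_def)

lemma divisor_add: "divisor D \<Longrightarrow> divisor E \<Longrightarrow> divisor (\<lambda>j. D j + E j)"
proof -
  assume "divisor D" "divisor E"
  then have "finite ({j \<in> J. D j \<noteq> 0} \<union> {j \<in> J. E j \<noteq> 0})" by (simp add: divisor_def)
  moreover have "{j \<in> J. D j + E j \<noteq> 0} \<subseteq> {j \<in> J. D j \<noteq> 0} \<union> {j \<in> J. E j \<noteq> 0}"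
  proof
    fix j assume "j \<in> {j \<in> J. D j + E j \<noteq> 0}"
    then show "j \<in> {j \<in> J. D j \<noteq> 0} \<union> {j \<in> J. E j \<noteq> 0}" by (cases "D j = 0") simp_all
  qed
  ultimately show ?thesis unfolding divisor_def by (rule finite_subset[rotated])
qed

lemma divisor_val: "x \<noteq> 0 \<Longrightarrow> divisor (\<lambda>j. val j x)"
  using finite_character by (simp add: divisor_def)

lemma val_add_ge:
  assumes "j \<in> J" "x \<noteq> 0" "y \<noteq> 0" "x + y \<noteq> 0" "c \<le> val j x" "c \<le> val j y"
  shows "c \<le> val j (x + y)"
  using valuation_add[OF val[OF assms(1)] assms(2-4)] assms(5,6) by simp

lemma fractional_bounded:
  assumes "fractional A" "j \<in> J"
  shows "{val j x | x. x \<in> A \<and> x \<noteq> 0} \<noteq> {}" "bdd_below {val j x | x. x \<in> A \<and> x \<noteq> 0}"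
proof -
  show "{val j x | x. x \<in> A \<and> x \<noteq> 0} \<noteq> {}" using assms by (auto simp: fractional_def)
  obtain d where d: "d \<noteq> 0" "\<And>x. x \<in> A \<Longrightarrow> d * x \<in> emb ` R"
    using assms by (auto simp: fractional_def)
  have "- val j d \<le> val j x" if "x \<in> A" "x \<noteq> 0" for x
  proof -
    have "d * x \<noteq> 0" using d(1) that by simp
    then have "0 \<le> val j (d * x)" using d(2)[OF that(1)] assms(2) unfolding in_R_iff by blast
    then show ?thesis using valuation_mult[OF val[OF assms(2)] d(1) that(2)] by simp
  qed
  then show "bdd_below {val j x | x. x \<in> A \<and> x \<noteq> 0}"
    by (intro bdd_belowI[of _ "- val j d"]) auto
qed

lemma content_le:
  assumes "fractional A" "j \<in> J" "x \<in> A" "x \<noteq> 0"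
  shows "content A j \<le> val j x"
  unfolding content_def using assms fractional_bounded by (intro cInf_lower) auto

lemma content_attained:
  assumes "fractional A" "j \<in> J"
  shows "\<exists>x\<in>A. x \<noteq> 0 \<and> val j x = content A j"
  using int_Inf_in[OF fractional_bounded[OF assms]] unfolding content_def by auto

lemma content_eqI:
  assumes "fractional A" "j \<in> J" "x \<in> A" "x \<noteq> 0" "val j x = c"
    and "\<And>y. y \<in> A \<Longrightarrow> y \<noteq> 0 \<Longrightarrow> c \<le> val j y"
  shows "content A j = c"
proof -
  obtain y where "y \<in> A" "y \<noteq> 0" "val j y = content A j" using content_attained[OF assms(1,2)] by blast
  then show ?thesis using content_le[OF assms(1-4)] assms(5) assms(6)[of y] by simp
qed

text \<open>Where a fixed nonzero member and a common denominator both have value 0, the minimum is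
  squeezed to 0. Finite character leaves only finitely many other indices.\<close>

lemma divisor_content:
  assumes A: "fractional A"
  shows "divisor (content A)"
proof -
  obtain y where y: "y \<in> A" "y \<noteq> 0" using A by (auto simp: fractional_def)
  obtain d where d: "d \<noteq> 0" "\<And>x. x \<in> A \<Longrightarrow> d * x \<in> emb ` R"
    using A by (auto simp: fractional_def)
  have "content A j = 0" if j: "j \<in> J" "val j y = 0" "val j d = 0" for j
  proof -
    obtain x where x: "x \<in> A" "x \<noteq> 0" "val j x = content A j"
      using content_attained[OF A j(1)] by auto
    have "d * x \<noteq> 0" using d(1) x(2) by simp
    then have "0 \<le> val j (d * x)" using d(2)[OF x(1)] j(1) unfolding in_R_iff by blast
    then have "0 \<le> content A j" using x d j valuation_mult[OF val[OF j(1)], of d x] by simp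
    then show ?thesis using content_le[OF A j(1) y] j(2) by simp
  qed
  then have "{j \<in> J. content A j \<noteq> 0} \<subseteq> {j \<in> J. val j y \<noteq> 0} \<union> {j \<in> J. val j d \<noteq> 0}"
    by auto
  then show ?thesis unfolding divisor_def
    by (rule finite_subset) (use finite_character y d in auto)
qed

text \<open>Membership in the ring is a condition on values, and at each index the least value on A
  is attained, so only these least values matter.\<close>

lemma colon_fractional:
  assumes A: "fractional A"
  shows "colon R A = ideal_of (\<lambda>j. - content A j)"
proof -
  have "(\<forall>y\<in>A. x * y \<in> emb ` R) \<longleftrightarrow> (\<forall>j\<in>J. - content A j \<le> val j x)" if "x \<noteq> 0" for x
  proof
    assume *: "\<forall>y\<in>A. x * y \<in> emb ` R"
    show "\<forall>j\<in>J. - content A j \<le> val j x"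
    proof
      fix j assume j: "j \<in> J"
      obtain y where y: "y \<in> A" "y \<noteq> 0" "val j y = content A j"
        using content_attained[OF A j] by auto
      have "x * y \<in> emb ` R" using * y by blast
      moreover have "x * y \<noteq> 0" using y(2) that by simp
      ultimately have "0 \<le> val j (x * y)" using j unfolding in_R_iff by blast
      then show "- content A j \<le> val j x" using y that by (simp add: valuation_mult[OF val[OF j]])
    qed
  next
    assume *: "\<forall>j\<in>J. - content A j \<le> val j x"
    show "\<forall>y\<in>A. x * y \<in> emb ` R"
    proof
      fix y assume y: "y \<in> A"
      have "0 \<le> val j (x * y)" if nz: "y \<noteq> 0" and j: "j \<in> J" for j
      proof -
        have "- content A j \<le> val j x" using * j by blast
        then show ?thesis
          using valuation_mult[OF val[OF j] \<open>x \<noteq> 0\<close> nz] content_le[OF A j y nz] by simp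
      qed
      then show "x * y \<in> emb ` R" unfolding in_R_iff by (cases "y = 0") auto
    qed
  qed
  moreover have "\<forall>y\<in>A. 0 * y \<in> emb ` R" by (auto simp: in_R_iff)
  ultimately have "(\<forall>y\<in>A. x * y \<in> emb ` R) \<longleftrightarrow> x = 0 \<or> (\<forall>j\<in>J. - content A j \<le> val j x)" for x
    by (cases "x = 0") simp_all
  then show ?thesis unfolding colon_def ideal_of_def by simp
qed

lemma exists_in_ideal_of:
  assumes "divisor D"
  shows "\<exists>x\<in>ideal_of D. x \<noteq> 0"
proof -
  obtain i where "i \<in> J" using J_nonempty by blast
  then obtain x where "x \<noteq> 0" "\<forall>j\<in>J. D j \<le> val j x"
    using approximation[of D i] assms unfolding divisor_def by blast
  then show ?thesis unfolding ideal_of_def by blast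
qed

lemma ideal_of_clears:
  assumes D: "divisor D"
  shows "\<exists>d\<in>R. d \<noteq> 0 \<and> (\<forall>x\<in>ideal_of D. emb d * x \<in> emb ` R)"
proof -
  \<comment> \<open>The bound 0 puts the element into the ring, and the bound - D j makes it a
    common denominator.\<close>
  have "divisor (\<lambda>j. max 0 (- D j))"
    using D unfolding divisor_def by (rule rev_finite_subset) auto
  then obtain y where y: "y \<in> ideal_of (\<lambda>j. max 0 (- D j))" "y \<noteq> 0"
    using exists_in_ideal_of by blast
  then have "y \<in> emb ` R" by (auto simp: in_R_iff ideal_of_def)
  then obtain d where d: "d \<in> R" "y = emb d" by auto
  have "y * x \<in> emb ` R" if "x \<in> ideal_of D" for x
  proof (cases "x = 0")
    case False
    have "0 \<le> val j (y * x)" if j: "j \<in> J" for j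
    proof -
      have "D j \<le> val j x" "max 0 (- D j) \<le> val j y"
        using \<open>x \<in> ideal_of D\<close> y False j unfolding ideal_of_def by blast+
      then show ?thesis by (simp add: valuation_mult[OF val[OF j] y(2) False])
    qed
    then show ?thesis unfolding in_R_iff by blast
  qed (simp add: in_R_iff)
  then show ?thesis using d y by (intro bexI[of _ d]) auto
qed

lemma fractional_ideal_of:
  assumes D: "divisor D"
  shows "fractional (ideal_of D)"
proof -
  obtain d where "d \<in> R" "d \<noteq> 0" "\<forall>x\<in>ideal_of D. emb d * x \<in> emb ` R"
    using ideal_of_clears[OF D] by blast
  then show ?thesis unfolding fractional_def using exists_in_ideal_of[OF D]
    by (intro conjI exI[of _ "emb d"]) auto
qed

lemma fractional_frac_ideal:
  assumes "frac_ideal R I"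
  shows "fractional I"
proof -
  obtain d where "d \<noteq> 0" "\<forall>x\<in>I. emb d * x \<in> emb ` R" using assms by (auto simp: frac_ideal_def)
  moreover have "\<exists>x\<in>I. x \<noteq> 0" using assms by (auto simp: frac_ideal_def)
  ultimately show ?thesis unfolding fractional_def
    by (intro conjI exI[of _ "emb d"]) auto
qed

text \<open>Approximation supplies an element that attains the bound at j, so the divisor can be
  read off from its ideal.\<close>

lemma content_ideal_of:
  assumes D: "divisor D" and j: "j \<in> J"
  shows "content (ideal_of D) j = D j"
proof -
  obtain x where x: "x \<noteq> 0" "val j x = D j" "\<forall>j\<in>J. D j \<le> val j x"
    using approximation[of D j] D j by (auto simp: divisor_def)
  show ?thesis
    by (rule content_eqI[OF fractional_ideal_of[OF D] j _ x(1,2)]) (use x j in \<open>auto simp: ideal_of_def\<close>)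
qed

lemma ideal_of_cong: "(\<And>j. j \<in> J \<Longrightarrow> D j = E j) \<Longrightarrow> ideal_of D = ideal_of E"
  by (auto simp: ideal_of_def)

lemma colon_ideal_of:
  assumes D: "divisor D"
  shows "colon R (ideal_of D) = ideal_of (\<lambda>j. - D j)"
  unfolding colon_fractional[OF fractional_ideal_of[OF D]]
  by (rule ideal_of_cong) (simp add: content_ideal_of D)

lemma frac_ideal_ideal_of:
  assumes D: "divisor D"
  shows "frac_ideal R (ideal_of D)"
  unfolding frac_ideal_def
proof (intro conjI ballI)
  show "ideal_of D \<noteq> {0}" using exists_in_ideal_of[OF D] by auto
  show "\<exists>d\<in>R. d \<noteq> 0 \<and> (\<forall>x\<in>ideal_of D. emb d * x \<in> emb ` R)" using ideal_of_clears[OF D] .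
next
  fix x y assume "x \<in> ideal_of D" "y \<in> ideal_of D"
  then show "x + y \<in> ideal_of D"
    using val_add_ge[of _ x y] by (cases "x = 0 \<or> y = 0") (auto simp: ideal_of_def)
next
  fix r x assume r: "r \<in> R" and x: "x \<in> ideal_of D"
  show "emb r * x \<in> ideal_of D"
  proof (cases "r = 0 \<or> x = 0")
    case False
    then have nz: "emb r \<noteq> 0" "x \<noteq> 0" by auto
    have "D j \<le> val j (emb r * x)" if j: "j \<in> J" for j
    proof -
      have "emb r \<in> emb ` R" using r by (rule imageI)
      then have "0 \<le> val j (emb r)" using nz j unfolding in_R_iff by blast
      moreover have "D j \<le> val j x" using x nz j unfolding ideal_of_def by blast
      ultimately show ?thesis by (simp add: valuation_mult[OF val[OF j] nz])
    qed
    then show ?thesis unfolding ideal_of_def by blast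
  qed (auto simp: ideal_of_def)
qed (auto simp: ideal_of_def)

lemma divisorial_ideal_of: "divisor D \<Longrightarrow> divisorial R (ideal_of D)"
  by (simp add: divisorial_def frac_ideal_ideal_of colon_ideal_of divisor_uminus)

lemma divisorial_eq_ideal_of:
  assumes "divisorial R I"
  shows "I = ideal_of (content I)" "divisor (content I)"
proof -
  have I: "fractional I" using assms by (simp add: divisorial_def fractional_frac_ideal)
  show c: "divisor (content I)" using divisor_content[OF I] .
  have "colon R (colon R I) = ideal_of (content I)"
    using c by (simp add: colon_fractional[OF I] colon_ideal_of divisor_uminus)
  then show "I = ideal_of (content I)" using assms by (simp add: divisorial_def)
qed

lemma vprod_ideal_of:
  assumes D: "divisor D" and E: "divisor E"
  shows "vprod R (ideal_of D) (ideal_of E) = ideal_of (\<lambda>j. D j + E j)"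
proof -
  let ?A = "{x * y | x y. x \<in> ideal_of D \<and> y \<in> ideal_of E}"
  obtain d where d: "d \<in> R" "d \<noteq> 0" "\<And>x. x \<in> ideal_of D \<Longrightarrow> emb d * x \<in> emb ` R"
    using ideal_of_clears[OF D] by blast
  obtain e where e: "e \<in> R" "e \<noteq> 0" "\<And>x. x \<in> ideal_of E \<Longrightarrow> emb e * x \<in> emb ` R"
    using ideal_of_clears[OF E] by blast
  have mult: "x * y \<in> emb ` R" if "x \<in> emb ` R" "y \<in> emb ` R" for x y
    using that by (auto simp: in_R_iff valuation_mult[OF val])
  have clear: "emb (d * e) * (x * y) \<in> emb ` R" if "x \<in> ideal_of D" "y \<in> ideal_of E" for x y
    using mult[OF d(3)[OF that(1)] e(3)[OF that(2)]] by (simp add: emb_mult ac_simps)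
  obtain x y where "x \<in> ideal_of D" "x \<noteq> 0" "y \<in> ideal_of E" "y \<noteq> 0"
    using exists_in_ideal_of D E by metis
  then have "\<exists>z\<in>?A. z \<noteq> 0" by (intro bexI[of _ "x * y"]) auto
  then have A: "fractional ?A" unfolding fractional_def
    using clear d e by (intro conjI exI[of _ "emb (d * e)"]) auto
  have c: "content ?A j = D j + E j" if j: "j \<in> J" for j
  proof -
    obtain x where x: "x \<noteq> 0" "val j x = D j" "\<forall>j\<in>J. D j \<le> val j x"
      using approximation[of D j] D j by (auto simp: divisor_def)
    obtain y where y: "y \<noteq> 0" "val j y = E j" "\<forall>j\<in>J. E j \<le> val j y"
      using approximation[of E j] E j by (auto simp: divisor_def)
    show ?thesis
    proof (rule content_eqI[OF A j, of "x * y"])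
      show "x * y \<in> ?A" using x y by (auto simp: ideal_of_def)
      show "val j (x * y) = D j + E j" using x y by (simp add: valuation_mult[OF val[OF j]])
    next
      fix z assume "z \<in> ?A" "z \<noteq> 0"
      then obtain x y where z: "z = x * y" "x \<in> ideal_of D" "y \<in> ideal_of E" by blast
      then have nz: "x \<noteq> 0" "y \<noteq> 0" using \<open>z \<noteq> 0\<close> by auto
      then have "D j \<le> val j x" "E j \<le> val j y" using z j unfolding ideal_of_def by blast+
      then show "D j + E j \<le> val j z"
        using z(1) valuation_mult[OF val[OF j] nz] by simp
    qed (use x y in simp)
  qed
  have "vprod R (ideal_of D) (ideal_of E) = ideal_of (content ?A)"
    unfolding vprod_def colon_fractional[OF A]
    by (simp add: colon_ideal_of divisor_uminus divisor_content[OF A])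
  also have "\<dots> = ideal_of (\<lambda>j. D j + E j)" by (rule ideal_of_cong) (rule c)
  finally show ?thesis .
qed

lemma principal_eq_ideal_of:
  assumes "x \<noteq> 0"
  shows "{x * emb r | r. r \<in> R} = ideal_of (\<lambda>j. val j x)"
proof -
  have "y \<in> (*) x ` (emb ` R) \<longleftrightarrow> y \<in> ideal_of (\<lambda>j. val j x)" for y
  proof
    assume "y \<in> (*) x ` (emb ` R)"
    then obtain z where z: "z \<in> emb ` R" "y = x * z" by auto
    then show "y \<in> ideal_of (\<lambda>j. val j x)"
      using assms by (cases "z = 0") (auto simp: in_R_iff ideal_of_def valuation_mult[OF val])
  next
    assume y: "y \<in> ideal_of (\<lambda>j. val j x)"
    then have "y / x \<in> emb ` R"
      using assms by (cases "y = 0") (auto simp: in_R_iff ideal_of_def valuation_divide[OF val])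
    moreover have "y = x * (y / x)" using assms by simp
    ultimately show "y \<in> (*) x ` (emb ` R)" by (metis imageI)
  qed
  then show ?thesis by (auto simp: image_image set_eq_iff image_iff)
qed

lemma carrier_divisor_group: "carrier (divisor_group R) = ideal_of ` {D. divisor D}"
  using divisorial_eq_ideal_of divisorial_ideal_of by (auto simp: divisor_group_def)

lemma group_divisor_group: "group (divisor_group R)"
proof (rule groupI)
  show "\<one>\<^bsub>divisor_group R\<^esub> \<in> carrier (divisor_group R)"
    unfolding carrier_divisor_group using divisor_zero by (simp add: divisor_group_def R_eq_ideal_of)
next
  fix I K assume "I \<in> carrier (divisor_group R)" "K \<in> carrier (divisor_group R)"
  then show "I \<otimes>\<^bsub>divisor_group R\<^esub> K \<in> carrier (divisor_group R)"
    unfolding carrier_divisor_group using divisor_add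
    by (auto simp: divisor_group_def vprod_ideal_of)
next
  fix I K L
  assume "I \<in> carrier (divisor_group R)" "K \<in> carrier (divisor_group R)" "L \<in> carrier (divisor_group R)"
  then show "I \<otimes>\<^bsub>divisor_group R\<^esub> K \<otimes>\<^bsub>divisor_group R\<^esub> L = I \<otimes>\<^bsub>divisor_group R\<^esub> (K \<otimes>\<^bsub>divisor_group R\<^esub> L)"
    unfolding carrier_divisor_group by (auto simp: divisor_group_def vprod_ideal_of divisor_add add.assoc)
next
  fix I assume "I \<in> carrier (divisor_group R)"
  then obtain D where D: "divisor D" "I = ideal_of D" by (auto simp: carrier_divisor_group)
  show "\<one>\<^bsub>divisor_group R\<^esub> \<otimes>\<^bsub>divisor_group R\<^esub> I = I"
    using D by (simp add: divisor_group_def R_eq_ideal_of vprod_ideal_of divisor_zero)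
  show "\<exists>K\<in>carrier (divisor_group R). K \<otimes>\<^bsub>divisor_group R\<^esub> I = \<one>\<^bsub>divisor_group R\<^esub>"
    unfolding carrier_divisor_group using D
    by (intro bexI[of _ "ideal_of (\<lambda>j. - D j)"])
      (auto simp: divisor_group_def R_eq_ideal_of vprod_ideal_of divisor_uminus)
qed

text \<open>First isomorphism theorem in a form that speaks of divisors only: composing \<phi> with
  \<open>content\<close> gives a homomorphism on divisorial ideals whose kernel consists of the
  principal ones. The congruence hypothesis is needed because \<open>content\<close> recovers a
  divisor only on \<open>J\<close>.\<close>

theorem class_group_iso:
  assumes H: "group H"
    and cong: "\<And>D E. (\<And>j. j \<in> J \<Longrightarrow> D j = E j) \<Longrightarrow> \<phi> D = \<phi> E"
    and carr: "\<And>D. divisor D \<Longrightarrow> \<phi> D \<in> carrier H"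
    and add: "\<And>D E. divisor D \<Longrightarrow> divisor E \<Longrightarrow> \<phi> (\<lambda>j. D j + E j) = \<phi> D \<otimes>\<^bsub>H\<^esub> \<phi> E"
    and surj: "\<And>h. h \<in> carrier H \<Longrightarrow> \<exists>D. divisor D \<and> \<phi> D = h"
    and ker: "\<And>D. divisor D \<Longrightarrow> \<phi> D = \<one>\<^bsub>H\<^esub> \<longleftrightarrow> (\<exists>x. x \<noteq> 0 \<and> (\<forall>j\<in>J. D j = val j x))"
  shows "class_group R \<cong> H"
proof -
  let ?\<psi> = "\<lambda>I. \<phi> (content I)"
  have \<psi>: "?\<psi> (ideal_of D) = \<phi> D" if "divisor D" for D
    using that by (intro cong content_ideal_of)
  have "?\<psi> \<in> hom (divisor_group R) H"
  proof (rule homI)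
    show "\<phi> (content I) \<in> carrier H" if "I \<in> carrier (divisor_group R)" for I
      using that by (auto simp: carrier_divisor_group \<psi> carr)
    show "\<phi> (content (I \<otimes>\<^bsub>divisor_group R\<^esub> K)) = \<phi> (content I) \<otimes>\<^bsub>H\<^esub> \<phi> (content K)"
      if IK: "I \<in> carrier (divisor_group R)" "K \<in> carrier (divisor_group R)" for I K
    proof -
      obtain D E where D: "divisor D" "I = ideal_of D" and E: "divisor E" "K = ideal_of E"
        using IK unfolding carrier_divisor_group by blast
      have "I \<otimes>\<^bsub>divisor_group R\<^esub> K = ideal_of (\<lambda>j. D j + E j)"
        using D E by (simp add: divisor_group_def vprod_ideal_of)
      then show ?thesis using D E by (simp add: \<psi> divisor_add add)
    qed
  qed
  then interpret group_hom "divisor_group R" H ?\<psi>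
    using H group_divisor_group by (simp add: group_hom_def group_hom_axioms_def)
  have "?\<psi> ` carrier (divisor_group R) = carrier H"
  proof -
    have "h \<in> ?\<psi> ` carrier (divisor_group R)" if h: "h \<in> carrier H" for h
    proof -
      obtain D where "divisor D" "\<phi> D = h" using surj[OF h] by auto
      then show ?thesis by (intro image_eqI[of _ _ "ideal_of D"]) (auto simp: \<psi> carrier_divisor_group)
    qed
    then show ?thesis by (auto simp: hom_closed)
  qed
  moreover have "kernel (divisor_group R) H ?\<psi> = principal_ideals R"
  proof -
    have "I \<in> kernel (divisor_group R) H ?\<psi> \<longleftrightarrow> (\<exists>x. x \<noteq> 0 \<and> I = ideal_of (\<lambda>j. val j x))" for I
    proof
      assume "I \<in> kernel (divisor_group R) H ?\<psi>"
      then obtain D where D: "divisor D" "I = ideal_of D" "\<phi> D = \<one>\<^bsub>H\<^esub>"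
        by (auto simp: kernel_def carrier_divisor_group \<psi>)
      then obtain x where "x \<noteq> 0" "\<forall>j\<in>J. D j = val j x" using ker by auto
      then have "I = ideal_of (\<lambda>j. val j x)" unfolding D(2) by (intro ideal_of_cong) simp
      then show "\<exists>x. x \<noteq> 0 \<and> I = ideal_of (\<lambda>j. val j x)"
        using \<open>x \<noteq> 0\<close> by (intro exI[of _ x] conjI)
    next
      assume "\<exists>x. x \<noteq> 0 \<and> I = ideal_of (\<lambda>j. val j x)"
      then obtain x where x: "x \<noteq> 0" "I = ideal_of (\<lambda>j. val j x)" by auto
      have "\<phi> (\<lambda>j. val j x) = \<one>\<^bsub>H\<^esub>" using ker[OF divisor_val[OF x(1)]] x(1) by auto
      then show "I \<in> kernel (divisor_group R) H ?\<psi>"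
        using x divisor_val by (auto simp: kernel_def carrier_divisor_group \<psi>)
    qed
    moreover have "principal_ideals R = {ideal_of (\<lambda>j. val j x) | x. x \<noteq> 0}"
      unfolding principal_ideals_def
    proof (intro Collect_cong ex_cong1)
      fix I x
      show "(I = {x * emb r | r. r \<in> R} \<and> x \<noteq> 0) = (I = ideal_of (\<lambda>j. val j x) \<and> x \<noteq> 0)"
        by (cases "x = 0") (simp_all add: principal_eq_ideal_of)
    qed
    ultimately show ?thesis by (simp add: set_eq_iff conj_commute)
  qed
  ultimately show ?thesis using FactGroup_iso by (simp add: class_group_def)
qed

end

section \<open>The rings and their valuations\<close>

lemma exists_prime_gt: "\<exists>p::int. prime p \<and> p > m"
proof -
  obtain q where "prime q" "q > nat \<bar>m\<bar>" using bigger_prime by blast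
  then show ?thesis by (intro exI[of _ "int q"]) auto
qed

text \<open>Growing faster than the values at \<open>2 n\<close> and \<open>2 n + 1\<close> of any fixed polynomial makes
  the family of valuations below have finite character.\<close>

primrec bprime :: "nat \<Rightarrow> int" where
  "bprime 0 = (SOME p. prime p \<and> p > 4)"
| "bprime (Suc n) = (SOME p. prime p \<and> p > max (bprime n) ((2 * int n + 4) ^ (2 * n + 4)))"

lemma bprime_Suc: "prime (bprime (Suc n)) \<and> bprime (Suc n) > max (bprime n) ((2 * int n + 4) ^ (2 * n + 4))"
  unfolding bprime.simps by (rule someI_ex) (rule exists_prime_gt)

declare bprime.simps(2) [simp del]

lemma bprime_0: "prime (bprime 0) \<and> bprime 0 > 4"
  unfolding bprime.simps by (rule someI_ex) (rule exists_prime_gt)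

lemma prime_bprime [simp]: "prime (bprime n)"
  using bprime_Suc bprime_0 by (cases n) blast+

text \<open>Both centers t over the index n satisfy t + 1 \<le> 2 n + 2, so the bound covers (t +
  1)^(t + 1) for either of them.\<close>

lemma bprime_gt: "bprime n > (2 * int n + 2) ^ (2 * n + 2)"
proof (cases n)
  case 0
  then show ?thesis using bprime_0 by simp
next
  case (Suc k)
  have eq: "2 * int n + 2 = 2 * int k + 4" "2 * n + 2 = 2 * k + 4" using Suc by simp_all
  show ?thesis unfolding eq unfolding Suc using bprime_Suc[of k] by (metis max_less_iff_conj)
qed

lemma strict_mono_bprime: "strict_mono bprime"
  unfolding strict_mono_Suc_iff using bprime_Suc by simp

lemma bprime_eq_iff [simp]: "bprime m = bprime n \<longleftrightarrow> m = n"
  using strict_mono_bprime by (simp add: strict_mono_eq)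

lemma bprime_gt_self: "int n < bprime n"
proof -
  have "int n < (2 * int n + 2) ^ 1" by simp
  also have "\<dots> \<le> (2 * int n + 2) ^ (2 * n + 2)" by (intro power_increasing) auto
  finally show ?thesis using bprime_gt[of n] by simp
qed

lemma bprime_nonzero [simp]: "bprime n \<noteq> 0"
  using bprime_gt_self[of n] by linarith

lemma padic_bprime: "padic (bprime n) (of_int (bprime k)) = (if n = k then 1 else 0)"
  by (simp add: padic_self padic_distinct_primes)

text \<open>The prime with index \<open>n\<close> carries the center \<open>2 n\<close> and, if it is to contribute an infinite
  cyclic summand (\<open>d n = 0\<close>), also the center \<open>2 n + 1\<close>.\<close>

definition centers :: "(nat \<Rightarrow> nat) \<Rightarrow> nat set \<Rightarrow> nat set" where
  "centers d M = {t. t div 2 \<in> M \<and> (odd t \<longrightarrow> d (t div 2) = 0)}"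

text \<open>The value e of the prime at its centers. Since \<open>d n = 0\<close> encodes an
  infinite cyclic summand, where both centers take e = 1, it is replaced by 1.\<close>

definition ram :: "(nat \<Rightarrow> nat) \<Rightarrow> nat \<Rightarrow> nat" where
  "ram d n = max 1 (d n)"

definition cval :: "(nat \<Rightarrow> nat) \<Rightarrow> nat \<Rightarrow> rat poly \<Rightarrow> int" where
  "cval d t = monval (bprime (t div 2)) (ram d (t div 2)) t"

definition kring :: "(nat \<Rightarrow> nat) \<Rightarrow> nat set \<Rightarrow> rat poly set" where
  "kring d M = {f. f = 0 \<or> (\<forall>t\<in>centers d M. 0 \<le> cval d t f)}"

definition lin :: "nat \<Rightarrow> rat poly" where
  "lin t = [:- of_nat t, 1:]"

lemma valuation_cval: "valuation (cval d t)"
  unfolding cval_def by (intro valuation_monval prime_bprime)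

lemma cval_const: "c \<noteq> 0 \<Longrightarrow> cval d t [:c:] = int (ram d (t div 2)) * padic (bprime (t div 2)) c"
  by (simp add: cval_def monval_const)

lemma cval_smult:
  "c \<noteq> 0 \<Longrightarrow> f \<noteq> 0 \<Longrightarrow> cval d t (smult c f) = int (ram d (t div 2)) * padic (bprime (t div 2)) c + cval d t f"
  by (simp add: cval_def monval_smult)

lemma cval_ZX_ge_0: "f \<in> ZX \<Longrightarrow> f \<noteq> 0 \<Longrightarrow> 0 \<le> cval d t f"
  by (simp add: cval_def monval_ZX_ge_0)

lemma ZX_subset_kring: "ZX \<subseteq> kring d M"
  by (auto simp: kring_def cval_ZX_ge_0)

lemma lin_nonzero [simp]: "lin t \<noteq> 0"
  by (simp add: lin_def)

lemma lin_ZX: "lin t \<in> ZX"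
  by (simp add: lin_def ZX_linear)

lemma cval_lin: "cval d t (lin t) = 1"
  by (simp add: cval_def lin_def monval_center)

text \<open>The two centers over one prime are consecutive integers, and no prime divides their
  difference.\<close>

lemma cval_lin_sibling:
  assumes "s div 2 = t div 2" "s \<noteq> t"
  shows "cval d t (lin s) = 0"
  unfolding cval_def
proof (rule monval_ZX_eq_0[OF prime_bprime lin_ZX lin_nonzero])
  show "poly (lin s) (of_nat t) = of_int (int t - int s)" by (simp add: lin_def)
  have "\<bar>int t - int s\<bar> = 1" using assms by presburger
  then show "\<not> bprime (t div 2) dvd int t - int s"
    by (metis dvd_abs_iff not_prime_unit prime_bprime)
qed

lemma clear_denominators: "\<exists>c::int. c \<noteq> 0 \<and> smult (of_int c) f \<in> ZX"
proof (induction f)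
  case 0
  then show ?case by (intro exI[of _ 1]) (auto simp: ZX_def)
next
  case (pCons a f)
  then obtain c :: int where c: "c \<noteq> 0" "smult (of_int c) f \<in> ZX" by auto
  obtain u w :: int where w: "w \<noteq> 0" "a = of_int u / of_int w" by (metis rat_fractionE)
  have f: "rat_of_int c * coeff f i \<in> \<int>" for i using c by (auto simp: ZX_def)
  have "rat_of_int (c * w) * a = of_int (c * u)" using w by simp
  then have "rat_of_int (c * w) * a \<in> \<int>" by (metis Ints_of_int)
  moreover have "rat_of_int (c * w) * coeff f i \<in> \<int>" for i
    using Ints_mult[OF Ints_of_int[of w] f[of i]] by (simp add: ac_simps)
  ultimately have "smult (of_int (c * w)) (pCons a f) \<in> ZX"
    by (auto simp: ZX_def coeff_pCons split: nat.splits)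
  then show ?case using c w by (intro exI[of _ "c * w"]) auto
qed

lemma ZX_poly_Ints:
  assumes "f \<in> ZX"
  shows "\<exists>b. poly f (of_nat a) = of_int b"
proof -
  have "poly f (of_nat a) \<in> \<int>" unfolding poly_altdef using assms
    by (intro Ints_sum Ints_mult Ints_power) (auto simp: ZX_def)
  then show ?thesis by (auto elim: Ints_cases)
qed

lemma abs_poly_le:
  fixes f :: "rat poly"
  shows "\<bar>poly f (of_nat t)\<bar> \<le> (\<Sum>i\<le>degree f. \<bar>coeff f i\<bar>) * of_nat ((t + 1) ^ degree f)"
proof -
  have "\<bar>poly f (of_nat t)\<bar> \<le> (\<Sum>i\<le>degree f. \<bar>coeff f i * of_nat t ^ i\<bar>)"
    unfolding poly_altdef by (rule sum_abs)
  also have "\<dots> \<le> (\<Sum>i\<le>degree f. \<bar>coeff f i\<bar> * of_nat ((t + 1) ^ degree f))"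
  proof (rule sum_mono)
    fix i assume "i \<in> {..degree f}"
    then have "t ^ i \<le> (t + 1) ^ degree f"
      by (intro order.trans[OF power_mono[of t "t + 1" i] power_increasing]) auto
    then have "(of_nat (t ^ i) :: rat) \<le> of_nat ((t + 1) ^ degree f)"
      by (simp only: of_nat_le_iff)
    then show "\<bar>coeff f i * of_nat t ^ i\<bar> \<le> \<bar>coeff f i\<bar> * of_nat ((t + 1) ^ degree f)"
      by (simp add: abs_mult mult_left_mono)
  qed
  finally show ?thesis by (simp add: sum_distrib_right)
qed

text \<open>A nonzero value at t forces the prime to divide f(t). Once t exceeds the degree and the
  sum of the absolute coefficients, f(t) is smaller than the prime, so t must be a root of f, and
  there are finitely many roots.\<close>

lemma finite_cval_nonzero_ZX:
  assumes f: "f \<in> ZX" "f \<noteq> 0"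
  shows "finite {t. cval d t f \<noteq> 0}"
proof -
  obtain C where C: "(\<Sum>i\<le>degree f. \<bar>coeff f i\<bar>) \<le> of_nat C"
    using real_arch_simple by blast
  have "poly f (of_nat t) = 0" if t: "cval d t f \<noteq> 0" "t \<ge> C" "t \<ge> degree f" for t
  proof (rule ccontr)
    assume nz: "poly f (of_nat t) \<noteq> 0"
    obtain b where b: "poly f (of_nat t) = of_int b" using ZX_poly_Ints[OF f(1)] by blast
    have "bprime (t div 2) dvd b"
      using t(1) monval_ZX_eq_0[OF prime_bprime f b] by (auto simp: cval_def)
    then have "bprime (t div 2) \<le> \<bar>b\<bar>"
      using nz b by (intro zdvd_imp_le) auto
    moreover have "\<bar>b\<bar> \<le> int ((t + 1) ^ (t + 1))"
    proof -
      have "C * (t + 1) ^ degree f \<le> (t + 1) * (t + 1) ^ degree f"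
        using t by (intro mult_right_mono) auto
      also have "\<dots> = (t + 1) ^ (degree f + 1)" by simp
      also have "\<dots> \<le> (t + 1) ^ (t + 1)" using t by (intro power_increasing) auto
      finally have *: "C * (t + 1) ^ degree f \<le> (t + 1) ^ (t + 1)" .
      have "rat_of_int \<bar>b\<bar> \<le> of_nat C * of_nat ((t + 1) ^ degree f)"
        using abs_poly_le[of f t] C b
        by (smt (verit) mult_right_mono of_nat_0_le_iff of_int_abs order.trans)
      also have "\<dots> \<le> of_nat ((t + 1) ^ (t + 1))"
        unfolding of_nat_mult[symmetric] using * by (simp only: of_nat_le_iff)
      finally have "rat_of_int \<bar>b\<bar> \<le> rat_of_int (int ((t + 1) ^ (t + 1)))" by simp
      then show ?thesis by (simp only: of_int_le_iff)
    qed
    moreover have "int ((t + 1) ^ (t + 1)) \<le> (2 * int (t div 2) + 2) ^ (2 * (t div 2) + 2)"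
    proof -
      have le: "t + 1 \<le> 2 * (t div 2) + 2" by presburger
      have "(t + 1) ^ (t + 1) \<le> (2 * (t div 2) + 2) ^ (t + 1)" using le by (rule power_mono) simp
      also have "\<dots> \<le> (2 * (t div 2) + 2) ^ (2 * (t div 2) + 2)" using le by (intro power_increasing) auto
      finally have "int ((t + 1) ^ (t + 1)) \<le> int ((2 * (t div 2) + 2) ^ (2 * (t div 2) + 2))"
        by (simp only: of_nat_le_iff)
      also have "\<dots> = (2 * int (t div 2) + 2) ^ (2 * (t div 2) + 2)"
        by (simp only: of_nat_power of_nat_add of_nat_mult of_nat_numeral)
      finally show ?thesis .
    qed
    ultimately show False using bprime_gt[of "t div 2"] by linarith
  qed
  then have "{t. cval d t f \<noteq> 0} \<subseteq> {..max C (degree f)} \<union> of_nat -` {x. poly f x = 0}"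
    by fastforce
  moreover have "finite (of_nat -` {x. poly f x = 0} :: nat set)"
    using poly_roots_finite[OF f(2)] by (intro finite_vimageI) (auto simp: inj_def)
  ultimately show ?thesis by (meson finite_Un finite_atMost finite_subset)
qed

lemma finite_bprime_dvd:
  assumes "c \<noteq> 0"
  shows "finite {t. bprime (t div 2) dvd c}"
proof (rule finite_subset)
  show "{t. bprime (t div 2) dvd c} \<subseteq> {..2 * nat \<bar>c\<bar> + 1}"
  proof
    fix t assume "t \<in> {t. bprime (t div 2) dvd c}"
    then have "bprime (t div 2) \<le> \<bar>c\<bar>" using assms by (intro zdvd_imp_le) auto
    then have "int (t div 2) < \<bar>c\<bar>" using bprime_gt_self[of "t div 2"] by linarith
    then show "t \<in> {..2 * nat \<bar>c\<bar> + 1}" by auto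
  qed
qed auto

lemma finite_cval_nonzero:
  assumes "f \<noteq> 0"
  shows "finite {t. cval d t f \<noteq> 0}"
proof -
  obtain c :: int where c: "c \<noteq> 0" "smult (of_int c) f \<in> ZX" using clear_denominators by blast
  have "cval d t (smult (of_int c) f) = cval d t f" if "\<not> bprime (t div 2) dvd c" for t
    using that c assms by (simp add: cval_smult padic_not_dvd)
  then have "{t. cval d t f \<noteq> 0} \<subseteq> {t. cval d t (smult (of_int c) f) \<noteq> 0} \<union> {t. bprime (t div 2) dvd c}"
    by auto
  then show ?thesis
    using finite_cval_nonzero_ZX[OF c(2)] finite_bprime_dvd[OF c(1)] c(1) assms
    by (auto intro: finite_subset)
qed

section \<open>The defining family of valuations and its approximation property\<close>

definition places :: "(nat \<Rightarrow> nat) \<Rightarrow> nat set \<Rightarrow> (nat + rat poly) set" where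
  "places d M = Inl ` centers d M \<union> Inr ` {q. prime q}"

definition place_val :: "(nat \<Rightarrow> nat) \<Rightarrow> nat + rat poly \<Rightarrow> qfun \<Rightarrow> int" where
  "place_val d = case_sum (\<lambda>t. fract_val (cval d t)) ordq"

lemma place_val_simps [simp]:
  "place_val d (Inl t) = fract_val (cval d t)" "place_val d (Inr q) = ordq q"
  by (simp_all add: place_val_def)

lemma discrete_place_val:
  assumes "j \<in> places d M"
  shows "discrete_valuation (place_val d j)"
  using assms unfolding places_def
proof (elim UnE imageE)
  fix t assume "j = Inl t"
  then show ?thesis
    using discrete_valuation_fract_val[OF valuation_cval lin_nonzero cval_lin] by simp
next
  fix q :: "rat poly" assume "j = Inr q" "q \<in> {q. prime q}"
  then show ?thesis
    using discrete_valuation_fract_val[of "pord q" q] by (auto simp: valuation_pord pord_prime)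
qed

lemma finite_place_val_nonzero:
  assumes "x \<noteq> 0"
  shows "finite {j \<in> places d M. place_val d j x \<noteq> 0}"
proof -
  obtain a b where b: "b \<noteq> 0" and x: "x = emb a / emb b" by (metis qfun_fractionE)
  have a: "a \<noteq> 0" using assms x by auto
  have "{j \<in> places d M. place_val d j x \<noteq> 0} \<subseteq>
      Inl ` ({t. cval d t a \<noteq> 0} \<union> {t. cval d t b \<noteq> 0}) \<union> Inr ` {q. prime q \<and> ordq q x \<noteq> 0}"
    using a b x by (auto simp: places_def fract_val_divide valuation_cval)
  then show ?thesis
    by (rule finite_subset) (use finite_cval_nonzero a b finite_ordq_nonzero assms in auto)
qed

lemma emb_kring: "emb ` kring d M = {x. x = 0 \<or> (\<forall>j\<in>places d M. 0 \<le> place_val d j x)}"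
proof (intro Set.set_eqI iffI)
  fix x assume "x \<in> emb ` kring d M"
  then obtain f where "f \<in> kring d M" "x = emb f" by blast
  then show "x \<in> {x. x = 0 \<or> (\<forall>j\<in>places d M. 0 \<le> place_val d j x)}"
    by (auto simp: kring_def places_def fract_val_emb valuation_cval valuation_pord pord_def)
next
  fix x assume "x \<in> {x. x = 0 \<or> (\<forall>j\<in>places d M. 0 \<le> place_val d j x)}"
  then consider "x = 0" | "x \<noteq> 0" "\<forall>j\<in>places d M. 0 \<le> place_val d j x" by blast
  then show "x \<in> emb ` kring d M"
  proof cases
    case 1
    then show ?thesis by (auto simp: kring_def intro!: image_eqI[of _ _ 0])
  next
    case x: 2
    have "0 \<le> ordq q x" if "prime q" for q
    proof -
      have "0 \<le> place_val d (Inr q) x" using x(2) that unfolding places_def by blast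
      then show ?thesis by simp
    qed
    then obtain f where f: "x = emb f" using ordq_nonneg_imp_emb x by blast
    have "0 \<le> cval d t f" if "t \<in> centers d M" for t
    proof -
      have "0 \<le> place_val d (Inl t) x" using x(2) that unfolding places_def by blast
      then show ?thesis using x(1) f by (simp add: fract_val_emb valuation_cval)
    qed
    then show ?thesis using f by (auto simp: kring_def)
  qed
qed

lemma krull_domain_kring: "krull_domain (kring d M)"
  unfolding krull_domain_def
proof (intro exI[of _ "place_val d ` places d M"] conjI allI impI ballI)
  show "emb ` kring d M = {x. x = 0 \<or> (\<forall>v\<in>place_val d ` places d M. 0 \<le> v x)}"
    by (simp add: emb_kring)
next
  fix x :: qfun assume "x \<noteq> 0"
  have "{v \<in> place_val d ` places d M. v x \<noteq> 0} = place_val d ` {j \<in> places d M. place_val d j x \<noteq> 0}"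
    by auto
  then show "finite {v \<in> place_val d ` places d M. v x \<noteq> 0}"
    using finite_place_val_nonzero[OF \<open>x \<noteq> 0\<close>] by simp
qed (auto simp: discrete_place_val)

text \<open>A power of the prime moves the values at all its centers, and powers of X - t correct
  each of them upwards. Away from n the prime has value 0 and the linear factors, occurring with
  nonnegative exponents, have nonnegative values.\<close>

lemma local_element:
  "\<exists>g. g \<noteq> 0 \<and> (\<forall>t\<in>centers d M. t div 2 = n \<longrightarrow> cval d t g = D t) \<and>
       (\<forall>t. t div 2 \<noteq> n \<longrightarrow> 0 \<le> cval d t g)"
proof -
  let ?e = "ram d n"
  \<comment> \<open>The largest exponent of the prime that leaves nonnegative exponents for the
    linear factors.\<close>
  define a where "a = (if d n = 0 then min (D (2 * n)) (D (2 * n + 1)) else D (2 * n) div int ?e)"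
  define i where "i = nat (D (2 * n) - int ?e * a)"
  define j where "j = (if d n = 0 then nat (D (2 * n + 1) - a) else 0)"
  have e: "d n = 0 \<Longrightarrow> ?e = 1" "?e > 0" by (auto simp: ram_def)
  have i: "int i = D (2 * n) - int ?e * a"
  proof (cases "d n = 0")
    case True
    then show ?thesis using e by (simp add: i_def a_def)
  next
    case False
    then have "D (2 * n) - int ?e * a = D (2 * n) mod int ?e"
      by (simp add: a_def minus_mult_div_eq_mod)
    then show ?thesis using e by (simp add: i_def)
  qed
  have j: "int j = D (2 * n + 1) - a" if "d n = 0"
    using that by (simp add: j_def a_def)
  define c where "c = rat_of_int (bprime n) powi a"
  have c: "c \<noteq> 0" by (simp add: c_def)
  define h where "h = lin (2 * n) ^ i * lin (2 * n + 1) ^ j"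
  have h: "h \<noteq> 0" by (simp add: h_def)
  have val: "cval d t (smult c h) = int (ram d (t div 2)) * (a * (if t div 2 = n then 1 else 0)) +
      int i * cval d t (lin (2 * n)) + int j * cval d t (lin (2 * n + 1))" for t
    using c h valuation_mult[OF valuation_cval, of "lin (2 * n) ^ i" "lin (2 * n + 1) ^ j" d t]
    by (simp add: cval_smult c_def padic_power_int padic_bprime h_def valuation_power valuation_cval)
  have "cval d t (smult c h) = D t" if t: "t \<in> centers d M" "t div 2 = n" for t
  proof -
    consider "t = 2 * n" | "t = 2 * n + 1" using t(2) by linarith
    then show ?thesis
    proof cases
      case 1
      then have "cval d t (lin (2 * n + 1)) = 0" by (intro cval_lin_sibling) auto
      then show ?thesis using 1 val[of t] cval_lin[of d t] i by simp
    next
      case 2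
      then have d: "d n = 0" using t by (auto simp: centers_def)
      have "cval d t (lin (2 * n)) = 0" using 2 by (intro cval_lin_sibling) auto
      then show ?thesis using 2 val[of t] cval_lin[of d t] j[OF d] e(1)[OF d] t(2) by simp
    qed
  qed
  moreover have "0 \<le> cval d t (smult c h)" if "t div 2 \<noteq> n" for t
    unfolding val using that by (simp add: cval_ZX_ge_0 lin_ZX)
  ultimately show ?thesis using c h by (intro exI[of _ "smult c h"]) auto
qed

lemma padic_prod:
  assumes "prime p" "finite A" "\<And>i. i \<in> A \<Longrightarrow> x i \<noteq> 0"
  shows "padic p (prod x A) = (\<Sum>i\<in>A. padic p (x i))"
  using assms(2,3) by (induction A) (auto simp: assms(1) padic_mult)

lemma padic_bprime_prod:
  assumes "finite A"
  shows "padic (bprime n) (\<Prod>k\<in>A. rat_of_int (bprime k) powi c k) = (if n \<in> A then c n else 0)"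
proof -
  have "padic (bprime n) (\<Prod>k\<in>A. rat_of_int (bprime k) powi c k) = (\<Sum>k\<in>A. if n = k then c k else 0)"
    using assms by (subst padic_prod) (simp_all add: padic_power_int padic_bprime if_distrib cong: if_cong)
  then show ?thesis using assms by simp
qed

text \<open>Large powers of the primes below the centers with a positive bound suffice, since each
  such prime has value at least 1 there. In the approximation \<open>N\<close> holds at most one
  index; in the localization it consists of the primes that are kept.\<close>

lemma dominating_integer:
  assumes fin: "finite {t \<in> centers d M. 0 < D t}"
    and N: "\<And>t. t \<in> centers d M \<Longrightarrow> t div 2 \<in> N \<Longrightarrow> D t \<le> 0"
  shows "\<exists>s::int. s \<noteq> 0 \<and> (\<forall>n\<in>N. \<not> bprime n dvd s) \<and> (\<forall>t\<in>centers d M. D t \<le> cval d t [:of_int s:])"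
proof -
  let ?S = "{t \<in> centers d M. 0 < D t}"
  define A where "A = (\<lambda>t. t div 2) ` ?S"
  \<comment> \<open>The sum of the finitely many positive bounds dominates each of them.\<close>
  define K where "K = nat (\<Sum>t\<in>?S. D t)"
  have A: "finite A" using fin by (simp add: A_def)
  have K: "D t \<le> int K" if "t \<in> ?S" for t
  proof -
    have "D t \<le> (\<Sum>t\<in>?S. D t)" using fin that by (intro member_le_sum) auto
    then show ?thesis by (simp add: K_def)
  qed
  define s where "s = (\<Prod>k\<in>A. bprime k ^ K)"
  have s0: "s \<noteq> 0" using A by (simp add: s_def)
  have "of_int s = (\<Prod>k\<in>A. rat_of_int (bprime k) powi int K)" by (simp add: s_def)
  then have p: "padic (bprime k) (of_int s) = (if k \<in> A then int K else 0)" for k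
    using padic_bprime_prod[OF A, of k "\<lambda>_. int K"] by simp
  have "\<not> bprime n dvd s" if n: "n \<in> N" for n
  proof
    assume "bprime n dvd s"
    then obtain k where k: "k \<in> A" "bprime n dvd bprime k ^ K"
      unfolding s_def using A by (auto simp: prime_dvd_prod_iff)
    then have "bprime n dvd bprime k" using prime_dvd_power by (metis prime_bprime)
    then have "k = n" using primes_dvd_imp_eq[of "bprime n" "bprime k"] by simp
    then show False using k(1) N n by (force simp: A_def)
  qed
  moreover have "D t \<le> cval d t [:of_int s:]" if t: "t \<in> centers d M" for t
  proof (cases "0 < D t")
    case False
    moreover have "0 \<le> cval d t [:of_int s:]" using s0 by (simp add: cval_const p)
    ultimately show ?thesis by linarith
  next
    case True
    then have "cval d t [:of_int s:] = int (ram d (t div 2)) * int K"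
      using s0 t by (auto simp: cval_const p A_def)
    moreover have "1 * int K \<le> int (ram d (t div 2)) * int K"
      by (intro mult_right_mono) (auto simp: ram_def)
    moreover have "D t \<le> int K" using K t True by blast
    ultimately show ?thesis by linarith
  qed
  ultimately show ?thesis using s0 by blast
qed

lemma place_val_mult_emb:
  assumes "j \<in> places d M" "x \<noteq> 0" "f \<noteq> 0"
  shows "place_val d j (x * emb f) = place_val d j x + place_val d j (emb f)"
  using assms valuation_mult[of "place_val d j" x "emb f"] discrete_place_val[of j d M]
  by (simp add: discrete_valuation_iff)

text \<open>Factorization in Q[X] settles all polynomial places at once and leaves a finitely
  supported problem at the centers. Both the approximation and the computation of the class group
  start here.\<close>

lemma exists_reduction:
  assumes "finite {j \<in> places d M. D j \<noteq> 0}"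
  shows "\<exists>x. x \<noteq> 0 \<and> (\<forall>q. prime q \<longrightarrow> ordq q x = D (Inr q)) \<and>
    finite {t \<in> centers d M. D (Inl t) - place_val d (Inl t) x \<noteq> 0}"
proof -
  have "finite (Inr -` {j \<in> places d M. D j \<noteq> 0})"
    using assms by (intro finite_vimageI) auto
  then have "finite {q. prime q \<and> D (Inr q) \<noteq> 0}"
    by (rule finite_subset[rotated]) (auto simp: places_def)
  then obtain x where x: "x \<noteq> 0" "\<forall>q. prime q \<longrightarrow> ordq q x = D (Inr q)"
    using exists_ordq_eq[of "\<lambda>q. D (Inr q)"] by auto
  have "finite (Inl -` ({j \<in> places d M. D j \<noteq> 0} \<union> {j \<in> places d M. place_val d j x \<noteq> 0}))"
    using assms finite_place_val_nonzero[OF x(1)] by (intro finite_vimageI) auto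
  then have "finite {t \<in> centers d M. D (Inl t) - place_val d (Inl t) x \<noteq> 0}"
    by (rule finite_subset[rotated]) (auto simp: places_def)
  then show ?thesis using x by blast
qed

text \<open>After the reduction the correcting factor is a polynomial, so it cannot lower any order
  at a polynomial place. If i is a center, a local element fixes the values over its prime and an
  integer handles the other primes; if i is a polynomial place, a constant is enough and leaves the
  order at i unchanged.\<close>

lemma kring_approximation:
  assumes D: "finite {j \<in> places d M. D j \<noteq> 0}" and i: "i \<in> places d M"
  shows "\<exists>x. x \<noteq> 0 \<and> place_val d i x = D i \<and> (\<forall>j\<in>places d M. D j \<le> place_val d j x)"
proof -
  obtain x where x: "x \<noteq> 0" "\<And>q. prime q \<Longrightarrow> ordq q x = D (Inr q)"
    and fin: "finite {t \<in> centers d M. D (Inl t) - place_val d (Inl t) x \<noteq> 0}"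
    using exists_reduction[OF D] by blast
  let ?D = "\<lambda>t. D (Inl t) - place_val d (Inl t) x"
  have "\<exists>f. f \<noteq> 0 \<and> (\<forall>t\<in>centers d M. ?D t \<le> cval d t f) \<and>
     (\<forall>t. i = Inl t \<longrightarrow> cval d t f = ?D t) \<and> (\<forall>q. i = Inr q \<longrightarrow> pord q f = 0)"
  proof (cases i)
    case (Inl s)
    then have s: "s \<in> centers d M" using i by (auto simp: places_def)
    \<comment> \<open>Over the prime of s the bound is replaced by 0, so that the integer can be
      chosen prime to it and does not disturb the values fixed by the local element.\<close>
    let ?E = "\<lambda>t. if t div 2 = s div 2 then 0 else ?D t"
    have "finite {t \<in> centers d M. 0 < ?E t}" by (rule finite_subset[OF _ fin]) auto
    then obtain m where m: "m \<noteq> 0" "\<not> bprime (s div 2) dvd m"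
      "\<forall>t\<in>centers d M. ?E t \<le> cval d t [:of_int m:]"
      using dominating_integer[of d M ?E "{s div 2}"] by auto
    define c where "c = rat_of_int m"
    have c: "c \<noteq> 0" "padic (bprime (s div 2)) c = 0"
      "\<forall>t\<in>centers d M. t div 2 \<noteq> s div 2 \<longrightarrow> ?D t \<le> cval d t [:c:]"
      using m by (auto simp: c_def padic_not_dvd split: if_splits)
    obtain g where g: "g \<noteq> 0" "\<forall>t\<in>centers d M. t div 2 = s div 2 \<longrightarrow> cval d t g = ?D t"
      "\<forall>t. t div 2 \<noteq> s div 2 \<longrightarrow> 0 \<le> cval d t g"
      using local_element[of d M "s div 2" ?D] by blast
    have val: "cval d t (smult c g) = cval d t [:c:] + cval d t g" for t
      using c g by (simp add: cval_smult cval_const)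
    have near: "cval d t (smult c g) = ?D t" if "t \<in> centers d M" "t div 2 = s div 2" for t
      using that c g by (simp add: cval_smult)
    have "?D t \<le> cval d t (smult c g)" if t: "t \<in> centers d M" for t
    proof (cases "t div 2 = s div 2")
      case False
      then have "?D t \<le> cval d t [:c:]" "0 \<le> cval d t g" using c g t by blast+
      then show ?thesis by (simp add: val)
    qed (simp add: near t)
    then show ?thesis using near[OF s] Inl c g by (intro exI[of _ "smult c g"]) simp
  next
    case (Inr q)
    have "finite {t \<in> centers d M. 0 < ?D t}" by (rule finite_subset[OF _ fin]) auto
    then obtain m where m: "m \<noteq> 0" "\<forall>t\<in>centers d M. ?D t \<le> cval d t [:of_int m:]"
      using dominating_integer[of d M ?D "{}"] by blast
    define c where "c = rat_of_int m"
    have "\<forall>t\<in>centers d M. ?D t \<le> cval d t [:c:]" and c: "c \<noteq> 0" using m by (auto simp: c_def)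
    moreover have "pord q [:c:] = 0" using c by (intro pord_unit is_unit_triv)
    ultimately show ?thesis using Inr c by (intro exI[of _ "[:c:]"]) simp
  qed
  then obtain f where f: "f \<noteq> 0" "\<And>t. t \<in> centers d M \<Longrightarrow> ?D t \<le> cval d t f"
    "\<And>t. i = Inl t \<Longrightarrow> cval d t f = ?D t" "\<And>q. i = Inr q \<Longrightarrow> pord q f = 0" by blast
  have "place_val d i (x * emb f) = D i"
    using i x f place_val_mult_emb[OF i x(1) f(1)]
    by (cases i) (auto simp: places_def fract_val_emb valuation_cval valuation_pord)
  moreover have "D j \<le> place_val d j (x * emb f)" if j: "j \<in> places d M" for j
  proof (cases j)
    case (Inl t)
    then have "t \<in> centers d M" using j by (auto simp: places_def)
    from f(2)[OF this] show ?thesis using place_val_mult_emb[OF j x(1) f(1)] Inl f(1)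
      by (simp add: fract_val_emb valuation_cval)
  next
    case (Inr q)
    then have "prime q" using j by (auto simp: places_def)
    then show ?thesis using place_val_mult_emb[OF j x(1) f(1)] Inr f(1) x(2)
      by (simp add: fract_val_emb valuation_pord pord_def)
  qed
  ultimately show ?thesis using x f by (intro exI[of _ "x * emb f"]) auto
qed

lemma krull_family_kring: "krull_family (kring d M) (places d M) (place_val d)"
proof
  \<comment> \<open>A prime divisor of X provides a place even when there are no centers.\<close>
  have "\<not> is_unit ([:0, 1:] :: rat poly)" by (simp add: is_unit_poly_iff)
  then obtain q :: "rat poly" where "prime q" using prime_divisor_exists[of "[:0, 1:] :: rat poly"] by auto
  then show "places d M \<noteq> {}" by (auto simp: places_def)
  show "valuation (place_val d j)" if "j \<in> places d M" for j
    using discrete_place_val[OF that] by (simp add: discrete_valuation_iff)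
qed (fact emb_kring finite_place_val_nonzero kring_approximation)+

section \<open>Purity\<close>

lemma kringI: "(\<And>t. t \<in> centers d M \<Longrightarrow> f \<noteq> 0 \<Longrightarrow> 0 \<le> cval d t f) \<Longrightarrow> f \<in> kring d M"
  by (auto simp: kring_def)

lemma kringD: "f \<in> kring d M \<Longrightarrow> f \<noteq> 0 \<Longrightarrow> t \<in> centers d M \<Longrightarrow> 0 \<le> cval d t f"
  by (auto simp: kring_def)

lemma kring_add:
  assumes "f \<in> kring d M" "g \<in> kring d M"
  shows "f + g \<in> kring d M"
proof (rule kringI)
  fix t assume t: "t \<in> centers d M" and nz: "f + g \<noteq> 0"
  show "0 \<le> cval d t (f + g)"
  proof (cases "f = 0 \<or> g = 0")
    case False
    then have "min (cval d t f) (cval d t g) \<le> cval d t (f + g)"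
      using nz by (intro valuation_add valuation_cval) auto
    then show ?thesis using kringD[OF assms(1) _ t] kringD[OF assms(2) _ t] False by simp
  qed (use kringD[OF assms(1) _ t] kringD[OF assms(2) _ t] nz in auto)
qed

lemma kring_mult:
  assumes "f \<in> kring d M" "g \<in> kring d M"
  shows "f * g \<in> kring d M"
proof (rule kringI)
  fix t assume t: "t \<in> centers d M" and nz: "f * g \<noteq> 0"
  then have "cval d t (f * g) = cval d t f + cval d t g" by (intro valuation_mult valuation_cval) auto
  then show "0 \<le> cval d t (f * g)" using kringD[OF assms(1) _ t] kringD[OF assms(2) _ t] nz by simp
qed

lemma kring_const_int: "[:of_int n:] \<in> kring d M"
  using ZX_subset_kring ZX_const[of "of_int n"] by auto

lemma kring_zero: "0 \<in> kring d M" and kring_one: "1 \<in> kring d M"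
  using kring_const_int[of 0 d M] kring_const_int[of 1 d M] by (simp_all add: one_pCons)

text \<open>The contraction to the ring of the maximal ideal of the valuation ring at t.\<close>

definition pos_ideal :: "(nat \<Rightarrow> nat) \<Rightarrow> nat set \<Rightarrow> nat \<Rightarrow> rat poly set" where
  "pos_ideal d M t = {f \<in> kring d M. f = 0 \<or> 0 < cval d t f}"

lemma ideal_pos_ideal:
  assumes t: "t \<in> centers d M"
  shows "ideal_in (kring d M) (pos_ideal d M t)"
  unfolding ideal_in_def
proof (intro conjI ballI)
  fix a b assume a: "a \<in> pos_ideal d M t" and b: "b \<in> pos_ideal d M t"
  have "0 < cval d t (a + b)" if "a + b \<noteq> 0" "a \<noteq> 0" "b \<noteq> 0"
    using valuation_add[OF valuation_cval that(2,3,1), of d t] a b that by (auto simp: pos_ideal_def)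
  then show "a + b \<in> pos_ideal d M t"
    using a b kring_add[of a d M b] by (cases "a = 0 \<or> b = 0") (auto simp: pos_ideal_def)
next
  fix r a assume r: "r \<in> kring d M" and a: "a \<in> pos_ideal d M t"
  have "0 < cval d t (r * a)" if "r \<noteq> 0" "a \<noteq> 0"
    using valuation_mult[OF valuation_cval that, of d t] a that kringD[OF r that(1) t]
    by (auto simp: pos_ideal_def)
  then show "r * a \<in> pos_ideal d M t"
    using a r kring_mult[of r d M a] by (cases "r = 0 \<or> a = 0") (auto simp: pos_ideal_def)
qed (auto simp: pos_ideal_def kring_zero)

lemma cval_one: "cval d t 1 = 0"
  by (rule valuation_one) (rule valuation_cval)

lemma prime_pos_ideal:
  assumes t: "t \<in> centers d M"
  shows "prime_ideal_in (kring d M) (pos_ideal d M t)"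
  unfolding prime_ideal_in_def
proof (intro conjI ballI impI)
  show "ideal_in (kring d M) (pos_ideal d M t)" by (rule ideal_pos_ideal[OF t])
  have "1 \<notin> pos_ideal d M t" by (simp add: pos_ideal_def cval_one)
  then show "pos_ideal d M t \<noteq> kring d M" using kring_one by metis
next
  fix a b assume a: "a \<in> kring d M" and b: "b \<in> kring d M" and ab: "a * b \<in> pos_ideal d M t"
  show "a \<in> pos_ideal d M t \<or> b \<in> pos_ideal d M t"
  proof (cases "a = 0 \<or> b = 0")
    case False
    then have "0 < cval d t a + cval d t b"
      using ab valuation_mult[OF valuation_cval, of a b d t] by (auto simp: pos_ideal_def)
    then have "0 < cval d t a \<or> 0 < cval d t b" by linarith
    then show ?thesis using a b by (auto simp: pos_ideal_def)
  qed (use a b in \<open>auto simp: pos_ideal_def\<close>)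
qed

lemma ram_pos: "0 < ram d n"
  by (simp add: ram_def)

lemma bprime_in_pos_ideal: "[:of_int (bprime (t div 2)):] \<in> pos_ideal d M t"
  using ram_pos[of d "t div 2"] by (simp add: pos_ideal_def kring_const_int cval_const padic_bprime)

lemma centers_over:
  assumes "t \<in> centers d M" "t div 2 = n"
  shows "t = 2 * n \<or> (t = 2 * n + 1 \<and> d n = 0)"
  using assms by (auto simp: centers_def elim!: oddE)

text \<open>The residue class of the following element at a center \<open>t\<close> over \<open>n\<close> is transcendental.\<close>

definition transc :: "(nat \<Rightarrow> nat) \<Rightarrow> nat \<Rightarrow> rat poly" where
  "transc d n = smult (inverse (of_int (bprime n)))
     (if d n = 0 then lin (2 * n) * lin (2 * n + 1) else lin (2 * n) ^ ram d n)"

lemma transc_nonzero [simp]: "transc d n \<noteq> 0"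
  by (simp add: transc_def)

text \<open>At each center over n the numerator has the same value as the prime: with two centers
  each linear factor contributes 1 at its own center and 0 at the other, with one center the
  exponent equals the value of the prime.\<close>

lemma cval_transc:
  assumes t: "t \<in> centers d M" "t div 2 = n"
  shows "cval d t (transc d n) = 0"
proof (cases "d n = 0")
  case True
  have "cval d t (lin (2 * n) * lin (2 * n + 1)) = 1"
    using centers_over[OF t] cval_lin[of d t] cval_lin_sibling[of _ t d]
    by (auto simp: valuation_mult[OF valuation_cval] t)
  then show ?thesis using True t
    by (simp add: transc_def cval_smult padic_inverse padic_bprime ram_def)
next
  case False
  then have "t = 2 * n" using centers_over[OF t] by simp
  then have "cval d t (lin (2 * n) ^ ram d n) = int (ram d n)"
    by (simp add: valuation_power valuation_cval cval_lin)
  then show ?thesis using False t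
    by (simp add: transc_def cval_smult padic_inverse padic_bprime)
qed

lemma transc_in_kring: "transc d n \<in> kring d M"
proof (rule kringI)
  fix t assume t: "t \<in> centers d M"
  show "0 \<le> cval d t (transc d n)"
  proof (cases "t div 2 = n")
    case True
    then show ?thesis using cval_transc[OF t] by simp
  next
    case False
    have "lin (2 * n) ^ k \<in> ZX" for k
      by (induction k) (auto simp: ZX_mult lin_ZX, auto simp: ZX_def)
    then have "(if d n = 0 then lin (2 * n) * lin (2 * n + 1) else lin (2 * n) ^ ram d n) \<in> ZX"
      by (auto simp: ZX_mult lin_ZX)
    then have "0 \<le> cval d t (if d n = 0 then lin (2 * n) * lin (2 * n + 1) else lin (2 * n) ^ ram d n)"
      by (rule cval_ZX_ge_0) simp
    then show ?thesis using False by (simp add: transc_def cval_smult padic_inverse padic_bprime)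
  qed
qed

definition cresdeg :: "(nat \<Rightarrow> nat) \<Rightarrow> nat \<Rightarrow> rat poly \<Rightarrow> nat" where
  "cresdeg d t = resdeg (bprime (t div 2)) (ram d (t div 2)) t"

lemma cresdeg_mult: "f \<noteq> 0 \<Longrightarrow> g \<noteq> 0 \<Longrightarrow> cresdeg d t (f * g) = cresdeg d t f + cresdeg d t g"
  by (simp add: cresdeg_def monval_mult)

lemma cresdeg_transc:
  assumes t: "t \<in> centers d M" "t div 2 = n"
  shows "0 < cresdeg d t (transc d n)"
proof -
  have lin: "cresdeg d t (lin t) = 1" by (simp add: cresdeg_def lin_def monval_center)
  have "\<exists>f. f \<noteq> 0 \<and> transc d n = lin t * f"
  proof (cases "d n = 0")
    case True
    then consider "t = 2 * n" | "t = 2 * n + 1" using centers_over[OF t] by auto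
    then show ?thesis
    proof cases
      case 1
      then show ?thesis using True
        by (intro exI[of _ "smult (inverse (of_int (bprime n))) (lin (2 * n + 1))"]) (simp add: transc_def)
    next
      case 2
      then show ?thesis using True
        by (intro exI[of _ "smult (inverse (of_int (bprime n))) (lin (2 * n))"]) (simp add: transc_def mult.commute)
    qed
  next
    case False
    then have "t = 2 * n" using centers_over[OF t] by simp
    moreover have "lin (2 * n) ^ ram d n = lin (2 * n) * lin (2 * n) ^ (ram d n - 1)"
      using ram_pos[of d n] by (metis power_eq_if less_irrefl)
    ultimately show ?thesis using False
      by (intro exI[of _ "smult (inverse (of_int (bprime n))) (lin (2 * n) ^ (ram d n - 1))"]) (simp add: transc_def)
  qed
  then show ?thesis using lin by (auto simp: cresdeg_mult)
qed

text \<open>Adjoining h = \<open>transc d (t div 2)\<close> to the prime gives a strictly larger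
  ideal. If it contained 1, then 1 - a = h r with a in the prime. The left side has residue degree
  0; the right side has positive degree, because degrees add and the polynomial r cannot have
  negative degree.\<close>

lemma not_maximal_pos_ideal:
  assumes t: "t \<in> centers d M"
  shows "\<not> maximal_ideal_in (kring d M) (pos_ideal d M t)"
proof
  let ?R = "kring d M" and ?Q = "pos_ideal d M t" and ?h = "transc d (t div 2)"
  define J where "J = {a + ?h * r | a r. a \<in> ?Q \<and> r \<in> ?R}"
  have Q: "?Q \<subseteq> ?R" "0 \<in> ?Q" "\<And>a b. a \<in> ?Q \<Longrightarrow> b \<in> ?Q \<Longrightarrow> a + b \<in> ?Q"
    "\<And>r a. r \<in> ?R \<Longrightarrow> a \<in> ?Q \<Longrightarrow> r * a \<in> ?Q"
    using ideal_pos_ideal[OF t] by (auto simp: ideal_in_def)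
  have "ideal_in ?R J"
    unfolding ideal_in_def
  proof (intro conjI ballI)
    show "J \<subseteq> ?R" using Q(1) by (auto simp: J_def intro!: kring_add kring_mult transc_in_kring)
    show "0 \<in> J" unfolding J_def using Q(2) kring_zero by (intro CollectI exI[of _ 0]) auto
  next
    fix x y assume "x \<in> J" "y \<in> J"
    then obtain a r b s where x: "x = a + ?h * r" "a \<in> ?Q" "r \<in> ?R"
      and y: "y = b + ?h * s" "b \<in> ?Q" "s \<in> ?R"
      unfolding J_def by blast
    have "x + y = (a + b) + ?h * (r + s)" using x y by (simp add: algebra_simps)
    then show "x + y \<in> J" unfolding J_def using Q(3)[OF x(2) y(2)] kring_add[OF x(3) y(3)] by blast
  next
    fix r x assume r: "r \<in> ?R" and "x \<in> J"
    then obtain a s where x: "x = a + ?h * s" "a \<in> ?Q" "s \<in> ?R" unfolding J_def by blast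
    have "r * x = r * a + ?h * (r * s)" using x by (simp add: algebra_simps)
    then show "r * x \<in> J" unfolding J_def using Q(4)[OF r x(2)] kring_mult[OF r x(3)] by blast
  qed
  moreover have "?Q \<subseteq> J"
  proof
    fix a assume "a \<in> ?Q"
    then show "a \<in> J" unfolding J_def using kring_zero by (intro CollectI exI[of _ a] exI[of _ 0]) auto
  qed
  moreover have "?h \<in> J" unfolding J_def using Q(2) kring_one by (intro CollectI exI[of _ 0] exI[of _ 1]) auto
  moreover have "?h \<notin> ?Q" using cval_transc[OF t refl] by (simp add: pos_ideal_def)
  moreover assume "maximal_ideal_in ?R ?Q"
  ultimately have "J = ?R" unfolding maximal_ideal_in_def by blast
  then have "1 \<in> J" using kring_one by simp
  then obtain a r where ar: "1 = a + ?h * r" "a \<in> ?Q" "r \<in> ?R" unfolding J_def by blast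
  have pos: "a = 0 \<or> 0 < monval (bprime (t div 2)) (ram d (t div 2)) t a"
    using ar(2) by (auto simp: pos_ideal_def cval_def)
  have eq: "1 - a = ?h * r" using ar(1) by (simp add: algebra_simps)
  have nz: "?h * r \<noteq> 0" and deg: "cresdeg d t (?h * r) = 0"
    using resdeg_one_minus[OF prime_bprime pos] unfolding eq cresdeg_def by auto
  then show False using cresdeg_transc[OF t refl] by (auto simp: cresdeg_mult)
qed

section \<open>Height-one primes containing a nonzero integer\<close>

lemma one_notin_prime_ideal:
  assumes Q: "prime_ideal_in R Q"
  shows "1 \<notin> Q"
proof
  assume "1 \<in> Q"
  then have "r \<in> Q" if "r \<in> R" for r
    using Q that by (metis ideal_in_def mult.right_neutral prime_ideal_in_def)
  then show False using Q by (auto simp: prime_ideal_in_def ideal_in_def)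
qed

lemma prime_ideal_prod:
  assumes Q: "prime_ideal_in R Q" and R: "1 \<in> R" "\<And>a b. a \<in> R \<Longrightarrow> b \<in> R \<Longrightarrow> a * b \<in> R"
    and "finite A" "\<And>i. i \<in> A \<Longrightarrow> f i \<in> R"
  shows "prod f A \<in> R \<and> (prod f A \<in> Q \<longrightarrow> (\<exists>i\<in>A. f i \<in> Q))"
  using assms(4,5)
proof (induction A)
  case empty
  show ?case using R one_notin_prime_ideal[OF Q] by simp
next
  case (insert i A)
  then show ?case using Q R by (auto simp: prime_ideal_in_def)
qed

lemma prime_ideal_power:
  assumes "prime_ideal_in R Q" "1 \<in> R" "\<And>a b. a \<in> R \<Longrightarrow> b \<in> R \<Longrightarrow> a * b \<in> R" "f \<in> R" "f ^ k \<in> Q"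
  shows "f \<in> Q"
  using prime_ideal_prod[of R Q "{..<k}" "\<lambda>_. f"] assms by auto

lemma prime_ideal_contains_prime:
  assumes Q: "prime_ideal_in R Q" and R: "\<And>n. [:of_int n:] \<in> R" and n: "n \<noteq> 0" "[:of_int n:] \<in> Q"
  shows "\<exists>p::int. prime p \<and> [:of_int p:] \<in> Q"
proof -
  have "\<exists>p. prime p \<and> [:of_int p:] \<in> Q" if "n \<noteq> 0" "[:rat_of_int n:] \<in> Q" for n :: int
    using that
  proof (induction n rule: prime_divisors_induct)
    case zero
    then show ?case by simp
  next
    case (unit x)
    from unit(1) obtain y where "1 = x * y" by (rule dvdE)
    then have "1 = [:rat_of_int y:] * [:of_int x:]" by (simp add: one_pCons mult.commute flip: of_int_mult)
    moreover have "[:rat_of_int y:] * [:of_int x:] \<in> Q"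
      using Q R unit.prems unfolding prime_ideal_in_def ideal_in_def by blast
    ultimately show ?case using one_notin_prime_ideal[OF Q] by simp
  next
    case (factor p x)
    have "[:rat_of_int p:] * [:of_int x:] \<in> Q" using factor.prems by (simp add: mult.commute)
    then have "[:rat_of_int p:] \<in> Q \<or> [:rat_of_int x:] \<in> Q"
      using Q R unfolding prime_ideal_in_def by blast
    then show ?case using factor by auto
  qed
  then show ?thesis using n by blast
qed

text \<open>Q contains a prime number p, and p lies below a center, since otherwise 1/p would be in
  the ring. If no ideal \<open>pos_ideal d M t\<close> over p were contained in Q, a product g of
  elements of these ideals outside Q would have a power divisible by p in the ring, putting g into
  Q. Height one turns the inclusion into equality.\<close>

lemma height_one_eq_pos_ideal:
  assumes Q: "height_one_prime_in (kring d M) Q" and n: "n \<noteq> 0" "[:of_int n:] \<in> Q"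
  shows "\<exists>t\<in>centers d M. Q = pos_ideal d M t"
proof -
  let ?R = "kring d M"
  have prime: "prime_ideal_in ?R Q" using Q by (simp add: height_one_prime_in_def)
  then have Q_mult: "\<And>r a. r \<in> ?R \<Longrightarrow> a \<in> Q \<Longrightarrow> r * a \<in> Q" and QR: "Q \<subseteq> ?R" "Q \<noteq> ?R" "0 \<in> Q"
    by (auto simp: prime_ideal_in_def ideal_in_def)
  note ring = kring_one kring_mult
  obtain p :: int where p: "prime p" "[:of_int p:] \<in> Q"
    using prime_ideal_contains_prime[OF prime kring_const_int n] by blast
  have p0: "p \<noteq> 0" using p by auto
  have "\<exists>s\<in>centers d M. p = bprime (s div 2)"
  proof (rule ccontr)
    assume "\<not> ?thesis"
    then have "[:inverse (of_int p):] \<in> ?R"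
      using p p0 by (intro kringI) (auto simp: cval_const padic_inverse padic_distinct_primes)
    from Q_mult[OF this p(2)] have "1 \<in> Q" using p0 by (simp add: one_pCons)
    then have "r \<in> Q" if "r \<in> ?R" for r using Q_mult[OF that] by force
    then show False using QR by blast
  qed
  then obtain s where s: "s \<in> centers d M" "p = bprime (s div 2)" by blast
  define T where "T = {t \<in> centers d M. t div 2 = s div 2}"
  have "T \<subseteq> {2 * (s div 2), 2 * (s div 2) + 1}" using centers_over by (auto simp: T_def)
  then have T: "finite T" by (rule finite_subset) auto
  have "\<exists>t\<in>T. pos_ideal d M t \<subseteq> Q"
  proof (rule ccontr)
    assume "\<not> ?thesis"
    then have "\<forall>t\<in>T. \<exists>f. f \<in> pos_ideal d M t \<and> f \<notin> Q" by blast
    then obtain f where f: "\<And>t. t \<in> T \<Longrightarrow> f t \<in> pos_ideal d M t" "\<And>t. t \<in> T \<Longrightarrow> f t \<notin> Q" by metis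
    have fR: "f t \<in> ?R" if "t \<in> T" for t using f(1)[OF that] by (simp add: pos_ideal_def)
    define g where "g = prod f T"
    have *: "g \<in> ?R \<and> (g \<in> Q \<longrightarrow> (\<exists>t\<in>T. f t \<in> Q))"
      unfolding g_def by (rule prime_ideal_prod[OF prime ring T fR])
    then have g: "g \<in> ?R" "g \<notin> Q" using f(2) by auto
    have g0: "g \<noteq> 0" using g(2) QR(3) by auto
    have pos: "0 < cval d t g" if t: "t \<in> T" for t
    proof -
      have "g = f t * prod f (T - {t})" unfolding g_def using T t by (rule prod.remove)
      moreover have "prod f (T - {t}) \<in> ?R"
        by (rule prime_ideal_prod[OF prime ring, THEN conjunct1]) (use T fR in auto)
      ultimately have "g \<in> pos_ideal d M t"
        using f(1)[OF t] ideal_pos_ideal[of t d M] t by (auto simp: T_def ideal_in_def mult.commute)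
      then show ?thesis using g0 by (simp add: pos_ideal_def)
    qed
    \<comment> \<open>g has value at least 1 at each center over p, so its k-th power compensates
      the value k of p.\<close>
    define k where "k = ram d (s div 2)"
    have h: "smult (inverse (of_int p)) (g ^ k) \<in> ?R"
    proof (rule kringI)
      fix t assume t: "t \<in> centers d M"
      have *: "cval d t (smult (inverse (of_int p)) (g ^ k)) =
          int k * cval d t g - int (ram d (t div 2)) * (if t div 2 = s div 2 then 1 else 0)"
        using g0 s by (simp add: cval_smult padic_inverse padic_bprime valuation_power valuation_cval)
      show "0 \<le> cval d t (smult (inverse (of_int p)) (g ^ k))"
      proof (cases "t div 2 = s div 2")
        case True
        then have "1 \<le> cval d t g" using pos[of t] t by (simp add: T_def)
        then have "int k * 1 \<le> int k * cval d t g" by (intro mult_left_mono) auto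
        then show ?thesis unfolding * using True by (simp add: k_def)
      next
        case False
        then show ?thesis unfolding * using kringD[OF g(1) g0 t] by simp
      qed
    qed
    have "g ^ k = smult (inverse (of_int p)) (g ^ k) * [:of_int p:]" using p0 by simp
    then have "g ^ k \<in> Q" using Q_mult[OF h p(2)] by simp
    then have "g \<in> Q" using prime_ideal_power[OF prime, of g k] g(1) ring by blast
    then show False using g by blast
  qed
  then obtain t where t: "t \<in> centers d M" "pos_ideal d M t \<subseteq> Q" by (auto simp: T_def)
  have "pos_ideal d M t \<noteq> {0}" using bprime_in_pos_ideal[of t d M] by auto
  then have "Q = pos_ideal d M t"
    using Q t prime_pos_ideal[OF t(1)] unfolding height_one_prime_in_def by blast
  then show ?thesis using t by blast
qed

theorem pure_polynomial_krull_domain_kring: "pure_polynomial_krull_domain (kring d M)"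
  unfolding pure_polynomial_krull_domain_def polynomial_krull_domain_def pure_def
  using ZX_subset_kring krull_domain_kring height_one_eq_pos_ideal not_maximal_pos_ideal by metis

section \<open>Finitely generated abelian groups\<close>

context comm_group
begin

text \<open>Generators form an indexed family, so that repetitions, which column operations may
  create, do no harm.\<close>

definition comb :: "'i set \<Rightarrow> ('i \<Rightarrow> 'a) \<Rightarrow> ('i \<Rightarrow> int) \<Rightarrow> 'a" where
  "comb A y c = finprod G (\<lambda>j. y j [^] c j) A"

definition combs :: "'i set \<Rightarrow> ('i \<Rightarrow> 'a) \<Rightarrow> 'a set" where
  "combs A y = range (comb A y)"

lemma comb_closed: "y \<in> A \<rightarrow> carrier G \<Longrightarrow> comb A y c \<in> carrier G"
  unfolding comb_def by (intro finprod_closed) auto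

lemma comb_cong:
  assumes "\<And>j. j \<in> A \<Longrightarrow> y j = z j" "\<And>j. j \<in> A \<Longrightarrow> c j = b j" "y \<in> A \<rightarrow> carrier G"
  shows "comb A y c = comb A z b"
  unfolding comb_def using assms by (intro finprod_cong') (auto simp: Pi_iff)

lemma comb_add:
  assumes "y \<in> A \<rightarrow> carrier G"
  shows "comb A y (\<lambda>j. c j + b j) = comb A y c \<otimes> comb A y b"
proof -
  have "comb A y c \<otimes> comb A y b = finprod G (\<lambda>j. y j [^] c j \<otimes> y j [^] b j) A"
    unfolding comb_def using assms by (intro finprod_multf[symmetric]) auto
  also have "\<dots> = comb A y (\<lambda>j. c j + b j)"
    unfolding comb_def using assms by (intro finprod_cong') (auto simp: int_pow_mult Pi_iff)
  finally show ?thesis by simp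
qed

lemma comb_zero: "(\<And>j. j \<in> A \<Longrightarrow> y j [^] c j = \<one>) \<Longrightarrow> comb A y c = \<one>"
  unfolding comb_def by (intro finprod_one_eqI) auto

lemma comb_scale:
  assumes "y \<in> A \<rightarrow> carrier G" "finite A"
  shows "comb A y (\<lambda>j. c j * n) = comb A y c [^] (n :: int)"
  using assms(2,1)
proof (induction A)
  case empty
  then show ?case by (simp add: comb_def)
next
  case (insert i A)
  then show ?case
    by (simp add: comb_def int_pow_distrib int_pow_pow Pi_iff)
qed

lemma comb_remove:
  assumes "finite A" "i \<in> A" "y \<in> A \<rightarrow> carrier G"
  shows "comb A y c = y i [^] c i \<otimes> comb (A - {i}) y c"
proof -
  have "comb (insert i (A - {i})) y c = y i [^] c i \<otimes> comb (A - {i}) y c"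
    unfolding comb_def using assms by (intro finprod_insert) auto
  then show ?thesis using assms by (simp add: insert_absorb)
qed

lemma comb_single:
  assumes "finite A" "i \<in> A" "y \<in> A \<rightarrow> carrier G"
  shows "comb A y (\<lambda>j. if j = i then n else 0) = y i [^] n"
proof -
  have "comb (A - {i}) y (\<lambda>j. if j = i then n else 0) = \<one>" by (intro comb_zero) auto
  then show ?thesis using assms comb_remove[OF assms, of "\<lambda>j. if j = i then n else 0"]
    by (auto simp: Pi_iff)
qed

text \<open>An elementary column operation on the generators is an elementary row operation on the
  coefficients.\<close>

lemma comb_shear:
  assumes A: "finite A" "i \<in> A" and y: "y \<in> A \<rightarrow> carrier G"
  shows "comb A (y(i := y i \<otimes> comb (A - {i}) y e)) c =
         comb A y (\<lambda>j. if j = i then c i else c j + e j * c i)"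
proof -
  let ?B = "A - {i}" and ?y = "y(i := y i \<otimes> comb (A - {i}) y e)"
  have yB: "y \<in> ?B \<rightarrow> carrier G" and yi: "y i \<in> carrier G" using y A by auto
  have y': "?y \<in> A \<rightarrow> carrier G" using y yi comb_closed[OF yB] by auto
  have "comb A ?y c = ?y i [^] c i \<otimes> comb ?B ?y c" by (rule comb_remove[OF A y'])
  also have "comb ?B ?y c = comb ?B y c" using yB by (intro comb_cong) auto
  also have "?y i [^] c i = y i [^] c i \<otimes> comb ?B y (\<lambda>j. e j * c i)"
    using yi comb_closed[OF yB, of e] A by (simp add: int_pow_distrib comb_scale[OF yB])
  also have "y i [^] c i \<otimes> comb ?B y (\<lambda>j. e j * c i) \<otimes> comb ?B y c =
      y i [^] c i \<otimes> comb ?B y (\<lambda>j. c j + e j * c i)"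
    using yi comb_closed[OF yB] by (simp add: comb_add[OF yB] m_assoc m_comm m_lcomm)
  also have "comb ?B y (\<lambda>j. c j + e j * c i) = comb ?B y (\<lambda>j. if j = i then c i else c j + e j * c i)"
    using yB by (intro comb_cong) auto
  finally have eq: "comb A ?y c = y i [^] c i \<otimes> comb ?B y (\<lambda>j. if j = i then c i else c j + e j * c i)" .
  show ?thesis
    unfolding eq comb_remove[OF A y, of "\<lambda>j. if j = i then c i else c j + e j * c i"] by simp
qed

lemma combs_shear:
  assumes A: "finite A" "i \<in> A" and y: "y \<in> A \<rightarrow> carrier G"
  shows "combs A (y(i := y i \<otimes> comb (A - {i}) y e)) = combs A y"
proof (intro Set.set_eqI iffI)
  fix g assume "g \<in> combs A (y(i := y i \<otimes> comb (A - {i}) y e))"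
  then show "g \<in> combs A y" unfolding combs_def using comb_shear[OF A y, of e] by auto
next
  fix g assume "g \<in> combs A y"
  then obtain c where c: "g = comb A y c" by (auto simp: combs_def)
  have "g = comb A (y(i := y i \<otimes> comb (A - {i}) y e)) (\<lambda>j. if j = i then c i else c j - e j * c i)"
    unfolding comb_shear[OF A y] c using y by (intro comb_cong) auto
  then show "g \<in> combs A (y(i := y i \<otimes> comb (A - {i}) y e))" by (auto simp: combs_def)
qed

text \<open>Among all nontrivial relations between generating families indexed by \<open>A\<close>, take one
  with a coefficient of minimal absolute value; column operations reduce the other coefficients
  modulo it, hence to 0, and split off a cyclic factor.\<close>

lemma exists_independent_generators:
  fixes A :: "nat set"
  assumes "finite A" "y \<in> A \<rightarrow> carrier G"
  shows "\<exists>z d. z \<in> A \<rightarrow> carrier G \<and> combs A z = combs A y \<and>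
           (\<forall>c. comb A z c = \<one> \<longleftrightarrow> (\<forall>j\<in>A. int (d j) dvd c j))"
  using assms
proof (induction A arbitrary: y rule: finite_psubset_induct)
  case (psubset A)
  define rel where "rel z c i \<longleftrightarrow>
    z \<in> A \<rightarrow> carrier G \<and> combs A z = combs A y \<and> comb A z c = \<one> \<and> i \<in> A \<and> c i \<noteq> 0" for z c i
  show ?case
  proof (cases "\<exists>z c i. rel z c i")
    case False
    \<comment> \<open>Without nontrivial relations the generators are free; this is encoded by the
      modulus 0, which divides only 0.\<close>
    have "comb A y c = \<one> \<longleftrightarrow> (\<forall>j\<in>A. int 0 dvd c j)" for c
    proof
      assume "comb A y c = \<one>"
      then show "\<forall>j\<in>A. int 0 dvd c j" using False psubset.prems by (auto simp: rel_def)
    qed (use comb_zero[of A y c] in auto)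
    then show ?thesis using psubset.prems by (intro exI[of _ y] exI[of _ "\<lambda>_. 0"]) auto
  next
    case True
    then have "\<exists>n z c i. rel z c i \<and> nat \<bar>c i\<bar> = n" by blast
    then obtain m where m: "\<exists>z c i. rel z c i \<and> nat \<bar>c i\<bar> = m"
      and least: "\<And>n. n < m \<Longrightarrow> \<not> (\<exists>z c i. rel z c i \<and> nat \<bar>c i\<bar> = n)"
      using exists_least_iff[of "\<lambda>n. \<exists>z c i. rel z c i \<and> nat \<bar>c i\<bar> = n"] by blast
    obtain z c i where rel: "rel z c i" and mi: "nat \<bar>c i\<bar> = m" using m by blast
    \<comment> \<open>A nonzero remainder modulo \<open>c i\<close> would be a smaller coefficient
      than the least one. This applies to the relation obtained by column operations and, later, to
      an arbitrary relation of the final family.\<close>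
    have minimal: "c' j mod c i = 0" if "rel' = \<one>" "rel' = comb A z' b" "z' \<in> A \<rightarrow> carrier G"
      "combs A z' = combs A y" "j \<in> A" "b j = c' j mod c i" for rel' z' b c' j
    proof (rule ccontr)
      assume "c' j mod c i \<noteq> 0"
      then have "rel z' b j" using that by (simp add: rel_def)
      moreover have "nat \<bar>b j\<bar> < m"
        using abs_mod_less[of "c i" "c' j"] rel that mi unfolding rel_def by linarith
      ultimately show False using least by blast
    qed
    have z: "z \<in> A \<rightarrow> carrier G" "combs A z = combs A y" "comb A z c = \<one>" and i: "i \<in> A" and ci: "c i \<noteq> 0"
      using rel by (auto simp: rel_def)
    let ?B = "A - {i}"
    \<comment> \<open>With the quotients as multipliers of the shear, the relation \<open>c\<close>
      for \<open>z\<close> becomes the relation \<open>b\<close> of remainders for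
      \<open>z'\<close>.\<close>
    define e where "e = (\<lambda>j. c j div c i)"
    define z' where "z' = z(i := z i \<otimes> comb ?B z e)"
    define b where "b = (\<lambda>j. if j = i then c i else c j mod c i)"
    have zB: "z \<in> ?B \<rightarrow> carrier G" using z by auto
    have z': "z' \<in> A \<rightarrow> carrier G" using z(1) i comb_closed[OF zB] by (auto simp: z'_def Pi_iff)
    have span': "combs A z' = combs A y"
      using combs_shear[OF psubset.hyps i z(1)] z(2) by (simp add: z'_def)
    have "comb A z' b = comb A z c"
      unfolding z'_def comb_shear[OF psubset.hyps i z(1)] using z(1)
      by (intro comb_cong) (auto simp: b_def e_def)
    then have rel': "comb A z' b = \<one>" using z by simp
    have "b j = 0" if j: "j \<in> ?B" for j
      using minimal[OF rel' refl z' span', of j c] j by (auto simp: b_def)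
    then have "comb ?B z' b = \<one>" by (intro comb_zero) simp
    moreover have zi: "z' i \<in> carrier G" using z' i by auto
    ultimately have torsion: "z' i [^] c i = \<one>"
      using comb_remove[OF psubset.hyps i z', of b] rel' by (simp add: b_def)
    have z'B: "z' \<in> ?B \<rightarrow> carrier G" using z' by auto
    moreover have "?B \<subset> A" using i by auto
    ultimately obtain u d where u: "u \<in> ?B \<rightarrow> carrier G" "combs ?B u = combs ?B z'"
      and d: "\<And>c. comb ?B u c = \<one> \<longleftrightarrow> (\<forall>j\<in>?B. int (d j) dvd c j)"
      using psubset.IH[of ?B z'] by blast
    define w where "w = u(i := z' i)"
    have w: "w \<in> A \<rightarrow> carrier G" using u zi by (auto simp: w_def)
    have comb_w: "comb A w f = z' i [^] f i \<otimes> comb ?B u f" for f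
    proof -
      have "w \<in> ?B \<rightarrow> carrier G" using w by auto
      then have "comb ?B w f = comb ?B u f" by (intro comb_cong) (auto simp: w_def)
      then show ?thesis using comb_remove[OF psubset.hyps i w, of f] by (simp add: w_def)
    qed
    have span_w: "combs A w = combs A y"
    proof -
      have 1: "\<exists>f'. comb ?B u f = comb ?B z' f'" "\<exists>f'. comb ?B z' f = comb ?B u f'" for f
        using u(2) unfolding combs_def by (metis rangeE rangeI)+
      have upd: "comb A w (f(i := k)) = z' i [^] k \<otimes> comb ?B u f"
        "comb A z' (f(i := k)) = z' i [^] k \<otimes> comb ?B z' f" for f k
        unfolding comb_w comb_remove[OF psubset.hyps i z']
        using comb_cong[of ?B u u "f(i := k)" f] comb_cong[of ?B z' z' "f(i := k)" f] u(1) z'B by auto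
      have "comb A w f \<in> combs A z'" for f
      proof -
        obtain f' where "comb ?B u f = comb ?B z' f'" using 1(1) by blast
        then have "comb A w f = comb A z' (f'(i := f i))" unfolding upd comb_w by simp
        then show ?thesis by (simp add: combs_def)
      qed
      moreover have "comb A z' f \<in> combs A w" for f
      proof -
        obtain f' where "comb ?B z' f = comb ?B u f'" using 1(2) by blast
        then have "comb A z' f = comb A w (f'(i := f i))"
          unfolding upd comb_remove[OF psubset.hyps i z'] by simp
        then show ?thesis by (simp add: combs_def)
      qed
      ultimately have "combs A w = combs A z'" unfolding combs_def[of A w] combs_def[of A z'] by blast
      then show ?thesis using span' by simp
    qed
    have "comb A w f = \<one> \<longleftrightarrow> (\<forall>j\<in>A. int ((d(i := m)) j) dvd f j)" for f
    proof
      assume f: "comb A w f = \<one>"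
      \<comment> \<open>Subtracting a multiple of the torsion relation of \<open>w i\<close> leaves
        a remainder modulo \<open>c i\<close> as the i-th coefficient. Minimality makes it 0, so
        every relation splits into one for \<open>w i\<close> and one for the other
        generators.\<close>
      have "comb A w (\<lambda>j. f j + (if j = i then - (f i div c i) * c i else 0)) =
          comb A w f \<otimes> w i [^] (- (f i div c i) * c i)"
        by (simp only: comb_add[OF w] comb_single[OF psubset.hyps i w])
      also have "w i [^] (- (f i div c i) * c i) = \<one>"
        using int_pow_pow[OF zi, of "c i" "- (f i div c i)"] torsion by (simp add: w_def mult.commute)
      finally have "comb A w (\<lambda>j. f j + (if j = i then - (f i div c i) * c i else 0)) = \<one>"
        using f by simp
      then have "f i mod c i = 0"
        using minimal[OF _ refl w span_w i, of _ f] by (simp add: minus_div_mult_eq_mod)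
      then have dvd: "c i dvd f i" by auto
      then obtain q where "f i = c i * q" by auto
      then have "z' i [^] f i = \<one>" using int_pow_pow[OF zi, of "c i" q] torsion by simp
      then have "comb ?B u f = \<one>" using f comb_w[of f] comb_closed[OF u(1)] by simp
      then have "\<forall>j\<in>?B. int (d j) dvd f j" using d by simp
      then show "\<forall>j\<in>A. int ((d(i := m)) j) dvd f j" using dvd mi by auto
    next
      assume f: "\<forall>j\<in>A. int ((d(i := m)) j) dvd f j"
      then have "c i dvd f i" using i mi by force
      then obtain q where "f i = c i * q" by auto
      then have "z' i [^] f i = \<one>" using int_pow_pow[OF zi, of "c i" q] torsion by simp
      moreover have "int (d j) dvd f j" if "j \<in> ?B" for j using f that by (cases "j = i") auto
      then have "comb ?B u f = \<one>" using d by blast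
      ultimately show "comb A w f = \<one>" by (simp add: comb_w)
    qed
    then show ?thesis using w span_w by blast
  qed
qed

lemma generate_subset_combs:
  assumes A: "finite A" and y: "y \<in> A \<rightarrow> carrier G"
  shows "generate G (y ` A) \<subseteq> combs A y"
proof
  fix g assume "g \<in> generate G (y ` A)"
  then show "g \<in> combs A y"
  proof induction
    case one
    have "\<one> = comb A y (\<lambda>_. 0)" by (simp add: comb_zero)
    then show ?case by (auto simp: combs_def)
  next
    case (incl h)
    then obtain i where i: "i \<in> A" "h = y i" by auto
    then have "h = comb A y (\<lambda>j. if j = i then 1 else 0)" using y by (auto simp: comb_single[OF A _ y] Pi_iff)
    then show ?case by (auto simp: combs_def)
  next
    case (inv h)
    then obtain i where i: "i \<in> A" "h = y i" by auto
    then have "inv h = comb A y (\<lambda>j. if j = i then -1 else 0)"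
      using y by (auto simp: comb_single[OF A _ y] int_pow_neg Pi_iff)
    then show ?case by (auto simp: combs_def)
  next
    case (eng h g)
    then obtain c b where "h = comb A y c" "g = comb A y b" by (auto simp: combs_def)
    then have "h \<otimes> g = comb A y (\<lambda>j. c j + b j)" by (simp add: comb_add y)
    then show ?case by (auto simp: combs_def)
  qed
qed

theorem finitely_generated_decomposition:
  assumes "finitely_generated_group G"
  shows "\<exists>(k::nat) z d. z \<in> {..<k} \<rightarrow> carrier G \<and> combs {..<k} z = carrier G \<and>
           (\<forall>c. comb {..<k} z c = \<one> \<longleftrightarrow> (\<forall>j<k. int (d j) dvd c j))"
proof -
  obtain S where S: "finite S" "S \<subseteq> carrier G" "generate G S = carrier G"
    using assms by (auto simp: finitely_generated_group_def)
  obtain y where y: "bij_betw y {..<card S} S"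
    using ex_bij_betw_nat_finite[OF S(1)] by (auto simp: lessThan_atLeast0)
  then have yS: "y ` {..<card S} = S" by (simp add: bij_betw_def)
  then have yc: "y \<in> {..<card S} \<rightarrow> carrier G" using S by auto
  have "carrier G \<subseteq> combs {..<card S} y"
    using generate_subset_combs[OF finite_lessThan yc] S yS by simp
  moreover have "combs {..<card S} y \<subseteq> carrier G"
    using comb_closed[OF yc] by (auto simp: combs_def)
  ultimately show ?thesis
    using exists_independent_generators[OF finite_lessThan yc] by (metis lessThan_iff subset_antisym)
qed

end

section \<open>Localization\<close>

definition away :: "nat set \<Rightarrow> int set" where
  "away N = {s. s \<noteq> 0 \<and> (\<forall>n\<in>N. \<not> bprime n dvd s)}"

lemma mult_subset_away: "mult_subset_int (away N)"
proof -
  have "\<bar>bprime n\<bar> \<noteq> 1" for n using prime_gt_1_int[OF prime_bprime, of n] by linarith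
  then show ?thesis by (auto simp: mult_subset_int_def away_def prime_dvd_mult_iff)
qed

text \<open>The inverted integers have value 0 at the centers over \<open>N\<close>, so these
  conditions survive. Conversely, an element satisfying them has negative values at only finitely
  many other centers, and a single integer prime to the primes of \<open>N\<close> compensates
  these.\<close>

lemma localize_kring:
  assumes "N \<subseteq> M"
  shows "localize (kring d M) (away N) = kring d N"
proof (intro Set.set_eqI iffI)
  have sub: "centers d N \<subseteq> centers d M" using assms by (auto simp: centers_def)
  {
    fix g assume "g \<in> localize (kring d M) (away N)"
    then obtain f s where f: "f \<in> kring d M" and s: "s \<in> away N" and g: "g = smult (1 / of_int s) f"
      by (auto simp: localize_def)
    show "g \<in> kring d N"
    proof (rule kringI)
      fix t assume t: "t \<in> centers d N" and "g \<noteq> 0"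
      then have f0: "f \<noteq> 0" using g by auto
      have "s \<noteq> 0" "\<not> bprime (t div 2) dvd s" using s t by (auto simp: away_def centers_def)
      then have "cval d t g = cval d t f"
        using f0 unfolding g by (simp add: cval_smult padic_inverse padic_not_dvd divide_inverse)
      then show "0 \<le> cval d t g" using kringD[OF f f0] t sub by auto
    qed
  }
  fix g assume g: "g \<in> kring d N"
  show "g \<in> localize (kring d M) (away N)"
  proof (cases "g = 0")
    case True
    have "1 \<in> away N" using mult_subset_away by (simp add: mult_subset_int_def)
    then show ?thesis unfolding localize_def using True kring_zero
      by (intro CollectI exI[of _ 0] exI[of _ 1]) auto
  next
    case False
    have "finite {t \<in> centers d M. 0 < - cval d t g}"
      by (rule finite_subset[OF _ finite_cval_nonzero[OF False, of d]]) auto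
    moreover have "- cval d t g \<le> 0" if "t \<in> centers d M" "t div 2 \<in> N" for t
      using kringD[OF g False, of t] that by (auto simp: centers_def)
    ultimately obtain s where s: "s \<noteq> 0" "\<forall>n\<in>N. \<not> bprime n dvd s"
      "\<forall>t\<in>centers d M. - cval d t g \<le> cval d t [:of_int s:]"
      using dominating_integer[of d M "\<lambda>t. - cval d t g" N] by blast
    have "smult (of_int s) g \<in> kring d M"
    proof (rule kringI)
      fix t assume "t \<in> centers d M"
      then have "- cval d t g \<le> cval d t [:of_int s:]" using s by blast
      then show "0 \<le> cval d t (smult (of_int s) g)"
        using s(1) False by (simp add: cval_smult cval_const)
    qed
    moreover have "g = smult (1 / of_int s) (smult (of_int s) g)" using s by simp
    moreover have "s \<in> away N" using s by (simp add: away_def)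
    ultimately show ?thesis unfolding localize_def by blast
  qed
qed

section \<open>The class group of the ring\<close>

text \<open>A surjection, with the stated kernel, onto \<open>H\<close> from the free abelian group on \<open>M\<close>, i.e. an
  isomorphism of \<open>H\<close> with the direct sum of the groups \<open>\<int> / d n\<close>.\<close>

definition presents :: "('h, 'x) monoid_scheme \<Rightarrow> (nat \<Rightarrow> nat) \<Rightarrow> nat set \<Rightarrow> ((nat \<Rightarrow> int) \<Rightarrow> 'h) \<Rightarrow> bool" where
  "presents H d M \<phi> \<longleftrightarrow>
     (\<forall>b c. (\<forall>n\<in>M. b n = c n) \<longrightarrow> \<phi> b = \<phi> c) \<and>
     (\<forall>c. finite {n \<in> M. c n \<noteq> 0} \<longrightarrow> \<phi> c \<in> carrier H) \<and>
     (\<forall>b c. finite {n \<in> M. b n \<noteq> 0} \<longrightarrow> finite {n \<in> M. c n \<noteq> 0} \<longrightarrow>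
        \<phi> (\<lambda>n. b n + c n) = \<phi> b \<otimes>\<^bsub>H\<^esub> \<phi> c) \<and>
     (\<forall>h\<in>carrier H. \<exists>c. finite {n \<in> M. c n \<noteq> 0} \<and> \<phi> c = h) \<and>
     (\<forall>c. finite {n \<in> M. c n \<noteq> 0} \<longrightarrow> (\<phi> c = \<one>\<^bsub>H\<^esub> \<longleftrightarrow> (\<forall>n\<in>M. int (d n) dvd c n)))"

text \<open>Then D minus the divisor of x is supported at the centers.\<close>

definition clears :: "(nat + rat poly \<Rightarrow> int) \<Rightarrow> qfun \<Rightarrow> bool" where
  "clears D x \<longleftrightarrow> x \<noteq> 0 \<and> (\<forall>q. prime q \<longrightarrow> ordq q x = D (Inr q))"

text \<open>The coordinate at the n-th prime of D minus the divisor of x. With two centers the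
  difference of the values realizes the isomorphism of Z^2/(1,1) with Z; with one center the value
  itself is kept, to be read modulo \<open>d n\<close>.\<close>

definition reduced :: "(nat \<Rightarrow> nat) \<Rightarrow> (nat + rat poly \<Rightarrow> int) \<Rightarrow> qfun \<Rightarrow> nat \<Rightarrow> int" where
  "reduced d D x n = (D (Inl (2 * n)) - place_val d (Inl (2 * n)) x) -
     (if d n = 0 then D (Inl (2 * n + 1)) - place_val d (Inl (2 * n + 1)) x else 0)"

lemma centers_even: "n \<in> M \<Longrightarrow> 2 * n \<in> centers d M"
  by (simp add: centers_def)

lemma centers_odd: "n \<in> M \<Longrightarrow> d n = 0 \<Longrightarrow> 2 * n + 1 \<in> centers d M"
  by (simp add: centers_def)

lemma valuation_place_val_Inl: "valuation (place_val d (Inl t))"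
  by (simp add: valuation_fract_val valuation_cval)

lemma place_val_const:
  "c \<noteq> 0 \<Longrightarrow> place_val d (Inl t) (emb [:c:]) = int (ram d (t div 2)) * padic (bprime (t div 2)) c"
  by (simp add: fract_val_emb valuation_cval cval_const)

lemma finite_reduced:
  assumes D: "finite {j \<in> places d M. D j \<noteq> 0}" and x: "x \<noteq> 0"
  shows "finite {n \<in> M. reduced d D x n \<noteq> 0}"
proof -
  let ?S = "{j \<in> places d M. D j \<noteq> 0} \<union> {j \<in> places d M. place_val d j x \<noteq> 0}"
  have zero: "D (Inl t) - place_val d (Inl t) x = 0" if "t \<in> centers d M" "Inl t \<notin> ?S" for t
    using that by (simp add: places_def)
  have "n \<in> (\<lambda>t. t div 2) ` (Inl -` ?S)" if n: "n \<in> M" "reduced d D x n \<noteq> 0" for n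
  proof (rule ccontr)
    assume *: "n \<notin> (\<lambda>t. t div 2) ` (Inl -` ?S)"
    have notin: "Inl t \<notin> ?S" if "t div 2 = n" for t
    proof
      assume "Inl t \<in> ?S"
      then have "t div 2 \<in> (\<lambda>t. t div 2) ` (Inl -` ?S)" by (intro imageI vimageI2)
      then show False using * that by (simp only:)
    qed
    have "D (Inl (2 * n)) - place_val d (Inl (2 * n)) x = 0"
      by (rule zero[OF centers_even[OF n(1)] notin]) simp
    moreover have "D (Inl (2 * n + 1)) - place_val d (Inl (2 * n + 1)) x = 0" if "d n = 0"
      by (rule zero[OF centers_odd[of n M d, OF n(1) that] notin]) simp
    ultimately have "reduced d D x n = 0" unfolding reduced_def by (cases "d n = 0") simp_all
    then show False using n(2) by contradiction
  qed
  then have "{n \<in> M. reduced d D x n \<noteq> 0} \<subseteq> (\<lambda>t. t div 2) ` (Inl -` ?S)" by blast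
  moreover have "finite (Inl -` ?S)"
    using D finite_place_val_nonzero[OF x] by (intro finite_vimageI) auto
  ultimately show ?thesis by (rule finite_subset[OF _ finite_imageI])
qed

text \<open>With two centers the contribution of c is the same at both and cancels, in accordance
  with \<open>d n = 0\<close>; with one center the prime has value \<open>d n\<close> when this is
  positive.\<close>

lemma reduced_scale:
  assumes x: "x \<noteq> 0" and c: "c \<noteq> 0"
  shows "reduced d D (x * emb [:c:]) n = reduced d D x n - int (d n) * padic (bprime n) c"
proof -
  have "place_val d (Inl t) (x * emb [:c:]) =
      place_val d (Inl t) x + int (ram d (t div 2)) * padic (bprime (t div 2)) c" for t
    using valuation_mult[OF valuation_place_val_Inl x, of "emb [:c:]" d t] c
    by (simp add: place_val_const[OF c, symmetric] del: place_val_simps)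
  then show ?thesis by (simp add: reduced_def ram_def)
qed

text \<open>The quotient of two such elements has order 0 at every irreducible polynomial, hence is
  a rational number.\<close>

lemma clears_unique:
  assumes "clears D x" "clears D y"
  shows "\<exists>c. c \<noteq> 0 \<and> y = x * emb [:c:]"
proof -
  have x: "x \<noteq> 0" and y: "y \<noteq> 0" using assms by (auto simp: clears_def)
  have "ordq q (y / x) = 0" if "prime q" for q
    using assms that by (simp add: clears_def valuation_divide valuation_ordq)
  then obtain c where "c \<noteq> 0" "y / x = emb [:c:]" using ordq_eq_0_imp_const[of "y / x"] x y by auto
  then show ?thesis using x by (intro exI[of _ c]) (auto simp: field_simps)
qed

text \<open>Modulo principal divisors every divisor is supported at the centers, and two such divisors
  are equivalent iff they differ by the divisor of a rational number.\<close>

theorem class_group_kring: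
  assumes H: "group H" and pres: "presents H d M \<phi>"
  shows "class_group (kring d M) \<cong> H"
proof -
  interpret krull_family "kring d M" "places d M" "place_val d" by (rule krull_family_kring)
  have cong: "\<And>b c. (\<And>n. n \<in> M \<Longrightarrow> b n = c n) \<Longrightarrow> \<phi> b = \<phi> c"
    and carr: "\<And>c. finite {n \<in> M. c n \<noteq> 0} \<Longrightarrow> \<phi> c \<in> carrier H"
    and add: "\<And>b c. finite {n \<in> M. b n \<noteq> 0} \<Longrightarrow> finite {n \<in> M. c n \<noteq> 0} \<Longrightarrow>
        \<phi> (\<lambda>n. b n + c n) = \<phi> b \<otimes>\<^bsub>H\<^esub> \<phi> c"
    and surj: "\<And>h. h \<in> carrier H \<Longrightarrow> \<exists>c. finite {n \<in> M. c n \<noteq> 0} \<and> \<phi> c = h"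
    and ker: "\<And>c. finite {n \<in> M. c n \<noteq> 0} \<Longrightarrow> \<phi> c = \<one>\<^bsub>H\<^esub> \<longleftrightarrow> (\<forall>n\<in>M. int (d n) dvd c n)"
    using pres unfolding presents_def by simp_all
  have fin: "finite {n \<in> M. reduced d D x n \<noteq> 0}" if "divisor D" "clears D x" for D x
    using that by (intro finite_reduced) (auto simp: divisor_def clears_def)
  have ex: "\<exists>x. clears D x" if "divisor D" for D
    using exists_reduction[of d M D] that by (auto simp: divisor_def clears_def)
  define \<psi> where "\<psi> D = \<phi> (reduced d D (SOME x. clears D x))" for D
  have \<psi>: "\<psi> D = \<phi> (reduced d D x)" if D: "divisor D" and x: "clears D x" for D x
  proof -
    let ?y = "SOME x. clears D x"
    have y: "clears D ?y" using x by (rule someI)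
    obtain c where c: "c \<noteq> 0" "?y = x * emb [:c:]" using clears_unique[OF x y] by blast
    \<comment> \<open>Another choice of x changes each coordinate by a multiple of
      \<open>d n\<close>, and such changes are killed by \<phi>.\<close>
    let ?r = "\<lambda>n. int (d n) * - padic (bprime n) c"
    have x0: "x \<noteq> 0" using x by (simp add: clears_def)
    have red: "reduced d D ?y n = reduced d D x n + ?r n" for n
      unfolding c(2) reduced_scale[OF x0 c(1)] by simp
    have "finite ({n \<in> M. reduced d D ?y n \<noteq> 0} \<union> {n \<in> M. reduced d D x n \<noteq> 0})"
      using fin D x y by simp
    then have r: "finite {n \<in> M. ?r n \<noteq> 0}"
    proof (rule finite_subset[rotated])
      show "{n \<in> M. ?r n \<noteq> 0} \<subseteq> {n \<in> M. reduced d D ?y n \<noteq> 0} \<union> {n \<in> M. reduced d D x n \<noteq> 0}"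
        using red by fastforce
    qed
    have "\<psi> D = \<phi> (\<lambda>n. reduced d D x n + ?r n)" unfolding \<psi>_def by (rule cong) (rule red)
    also have "\<dots> = \<phi> (reduced d D x) \<otimes>\<^bsub>H\<^esub> \<phi> ?r" by (rule add[OF fin[OF D x] r])
    also have "\<phi> ?r = \<one>\<^bsub>H\<^esub>" using ker[OF r] by simp
    finally show ?thesis using carr[OF fin[OF D x]] H by (simp add: group.is_monoid monoid.r_one)
  qed
  show ?thesis
  proof (rule class_group_iso[OF H, of \<psi>])
    fix D E :: "nat + rat poly \<Rightarrow> int"
    assume DE: "\<And>j. j \<in> places d M \<Longrightarrow> D j = E j"
    then have "clears D = clears E" by (auto simp: clears_def places_def fun_eq_iff)
    moreover have "\<phi> (reduced d D x) = \<phi> (reduced d E x)" for x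
    proof (rule cong)
      fix n assume n: "n \<in> M"
      have "D (Inl (2 * n)) = E (Inl (2 * n))" "d n = 0 \<Longrightarrow> D (Inl (2 * n + 1)) = E (Inl (2 * n + 1))"
        using DE centers_even[OF n, of d] centers_odd[OF n, of d] by (auto simp: places_def)
      then show "reduced d D x n = reduced d E x n" by (simp add: reduced_def)
    qed
    ultimately show "\<psi> D = \<psi> E" by (simp add: \<psi>_def)
  next
    fix D assume D: "divisor D"
    obtain x where x: "clears D x" using ex[OF D] by blast
    show "\<psi> D \<in> carrier H" using \<psi>[OF D x] carr[OF fin[OF D x]] by simp
  next
    fix D E assume D: "divisor D" and E: "divisor E"
    obtain x where x: "clears D x" using ex[OF D] by blast
    obtain y where y: "clears E y" using ex[OF E] by blast
    have nz: "x \<noteq> 0" "y \<noteq> 0" using x y by (auto simp: clears_def)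
    have "clears (\<lambda>j. D j + E j) (x * y)"
      using x y by (auto simp: clears_def valuation_mult valuation_ordq)
    then have "\<psi> (\<lambda>j. D j + E j) = \<phi> (reduced d (\<lambda>j. D j + E j) (x * y))"
      by (intro \<psi> divisor_add D E)
    also have "\<dots> = \<phi> (\<lambda>n. reduced d D x n + reduced d E y n)"
    proof (rule cong)
      fix n
      show "reduced d (\<lambda>j. D j + E j) (x * y) n = reduced d D x n + reduced d E y n"
        unfolding reduced_def using valuation_mult[OF valuation_place_val_Inl nz, of d] by simp
    qed
    also have "\<dots> = \<psi> D \<otimes>\<^bsub>H\<^esub> \<psi> E"
      unfolding \<psi>[OF D x] \<psi>[OF E y] by (rule add[OF fin[OF D x] fin[OF E y]])
    finally show "\<psi> (\<lambda>j. D j + E j) = \<psi> D \<otimes>\<^bsub>H\<^esub> \<psi> E" .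
  next
    fix h assume "h \<in> carrier H"
    then obtain c where c: "finite {n \<in> M. c n \<noteq> 0}" "\<phi> c = h" using surj by blast
    \<comment> \<open>The coefficients are placed at the even centers; all orders at polynomials are
      0, so x = 1 clears this divisor.\<close>
    define D :: "nat + rat poly \<Rightarrow> int" where
      "D = case_sum (\<lambda>t. if even t then c (t div 2) else 0) (\<lambda>_. 0)"
    have "{j \<in> places d M. D j \<noteq> 0} \<subseteq> Inl ` (\<lambda>n. 2 * n) ` {n \<in> M. c n \<noteq> 0}"
      by (auto simp: places_def centers_def D_def image_iff split: if_splits elim!: evenE)
    then have D: "divisor D" unfolding divisor_def by (rule finite_subset) (use c in auto)
    have one: "clears D 1" by (auto simp: clears_def D_def valuation_one valuation_ordq)
    have "\<phi> (reduced d D 1) = \<phi> c"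
      by (rule cong)
        (simp add: reduced_def D_def valuation_one[OF valuation_fract_val[OF valuation_cval]])
    then show "\<exists>D. divisor D \<and> \<psi> D = h" using D \<psi>[OF D one] c by auto
  next
    fix D assume D: "divisor D"
    show "\<psi> D = \<one>\<^bsub>H\<^esub> \<longleftrightarrow> (\<exists>x. x \<noteq> 0 \<and> (\<forall>j\<in>places d M. D j = place_val d j x))"
    proof
      assume "\<exists>x. x \<noteq> 0 \<and> (\<forall>j\<in>places d M. D j = place_val d j x)"
      then obtain x where x: "x \<noteq> 0" "\<And>j. j \<in> places d M \<Longrightarrow> D j = place_val d j x" by blast
      then have cl: "clears D x" by (auto simp: clears_def places_def)
      have "reduced d D x n = 0" if n: "n \<in> M" for n
        using x(2)[of "Inl (2 * n)"] x(2)[of "Inl (2 * n + 1)"] centers_even[OF n, of d] centers_odd[OF n, of d]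
        by (auto simp: reduced_def places_def)
      then show "\<psi> D = \<one>\<^bsub>H\<^esub>" using ker[OF fin[OF D cl]] \<psi>[OF D cl] by simp
    next
      assume one: "\<psi> D = \<one>\<^bsub>H\<^esub>"
      obtain x where cl: "clears D x" using ex[OF D] by blast
      then have x: "x \<noteq> 0" by (simp add: clears_def)
      have dvd: "int (d n) dvd reduced d D x n" if "n \<in> M" for n
        using ker[OF fin[OF D cl]] \<psi>[OF D cl] one that by simp
      define a where "a = (\<lambda>t. D (Inl t) - place_val d (Inl t) x)"
      \<comment> \<open>The exponent of the n-th prime in the rational number that is to have the
        remaining values \<open>a\<close>; divisibility by \<open>ram d n\<close> follows from the
        kernel condition.\<close>
      define k where "k = (\<lambda>n. a (2 * n) div int (ram d n))"
      have red: "reduced d D x n = a (2 * n) - (if d n = 0 then a (2 * n + 1) else 0)" for n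
        by (simp add: reduced_def a_def)
      have "finite {t \<in> centers d M. a t \<noteq> 0}"
      proof -
        have "finite (Inl -` ({j \<in> places d M. D j \<noteq> 0} \<union> {j \<in> places d M. place_val d j x \<noteq> 0}))"
          using D finite_character[OF x] by (intro finite_vimageI) (auto simp: divisor_def)
        then show ?thesis by (rule finite_subset[rotated]) (auto simp: places_def a_def)
      qed
      then have "finite ((\<lambda>t. t div 2) ` {t \<in> centers d M. a t \<noteq> 0})" by simp
      moreover have "{n \<in> M. k n \<noteq> 0} \<subseteq> (\<lambda>t. t div 2) ` {t \<in> centers d M. a t \<noteq> 0}"
      proof
        fix n assume "n \<in> {n \<in> M. k n \<noteq> 0}"
        then have "2 * n \<in> {t \<in> centers d M. a t \<noteq> 0}" by (auto simp: k_def centers_def)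
        then show "n \<in> (\<lambda>t. t div 2) ` {t \<in> centers d M. a t \<noteq> 0}" by (rule rev_image_eqI) simp
      qed
      ultimately have A: "finite {n \<in> M. k n \<noteq> 0}" by (rule finite_subset[rotated])
      define c where "c = (\<Prod>n\<in>{n \<in> M. k n \<noteq> 0}. rat_of_int (bprime n) powi k n)"
      have c: "c \<noteq> 0" using A by (simp add: c_def)
      have pad: "padic (bprime n) c = k n" if "n \<in> M" for n
        using padic_bprime_prod[OF A, of n k] that by (auto simp: c_def)
      have val: "a t = int (ram d (t div 2)) * k (t div 2)" if t: "t \<in> centers d M" for t
      proof -
        define n where "n = t div 2"
        have n: "n \<in> M" "t = 2 * n \<or> (t = 2 * n + 1 \<and> d n = 0)"
          using t centers_over[OF t refl] by (auto simp: centers_def n_def)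
        show ?thesis
        proof (cases "d n = 0")
          case True
          \<comment> \<open>Here the kernel condition is divisibility by 0, so the two values agree
            and one power of the prime serves both centers.\<close>
          then have "a (2 * n) = a (2 * n + 1)" using dvd[OF n(1)] red[of n] by simp
          then show ?thesis using n(2) True unfolding n_def[symmetric] by (auto simp: k_def ram_def)
        next
          case False
          then have "int (ram d n) dvd a (2 * n)" using dvd[OF n(1)] red[of n] by (simp add: ram_def)
          then show ?thesis using n(2) False unfolding n_def[symmetric] by (auto simp: k_def)
        qed
      qed
      have "D j = place_val d j (x * emb [:c:])" if j: "j \<in> places d M" for j
      proof (cases j)
        case (Inl t)
        then have t: "t \<in> centers d M" using j by (auto simp: places_def)
        then have "t div 2 \<in> M" by (simp add: centers_def)
        then have "padic (bprime (t div 2)) c = k (t div 2)" by (rule pad)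
        then have "place_val d (Inl t) (emb [:c:]) = a t"
          unfolding place_val_const[OF c] val[OF t] by (simp only:)
        then show ?thesis
          using valuation_mult[OF valuation_place_val_Inl x, of "emb [:c:]" d t] c Inl
          by (simp add: a_def)
      next
        case (Inr q)
        then have q: "prime q" using j by (auto simp: places_def)
        have "ordq q (emb [:c:]) = 0"
          using c q by (simp add: fract_val_emb valuation_pord pord_unit is_unit_triv)
        then show ?thesis
          using valuation_mult[OF valuation_ordq[OF q] x, of "emb [:c:]"] c cl q Inr
          by (simp add: clears_def)
      qed
      then show "\<exists>x. x \<noteq> 0 \<and> (\<forall>j\<in>places d M. D j = place_val d j x)"
        using x c by (intro exI[of _ "x * emb [:c:]"]) auto
    qed
  qed
qed

section \<open>Direct sums\<close>

text \<open>Renames the cyclic summands by indices of primes. Injectivity of \<iota> allows their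
  coefficients to be prescribed independently.\<close>

lemma presents_decomposition:
  fixes G :: "('a, 'x) monoid_scheme" and k :: nat
  assumes G: "comm_group G" and z: "z \<in> {..<k} \<rightarrow> carrier G"
    and gen: "comm_group.combs G {..<k} z = carrier G"
    and indep: "\<And>c. comm_group.comb G {..<k} z c = \<one>\<^bsub>G\<^esub> \<longleftrightarrow> (\<forall>j<k. int (\<delta> j) dvd c j)"
    and inj: "inj_on \<iota> {..<k}" and d: "\<And>j. j < k \<Longrightarrow> d (\<iota> j) = \<delta> j"
  shows "presents G d (\<iota> ` {..<k}) (\<lambda>c. comm_group.comb G {..<k} z (\<lambda>j. c (\<iota> j)))"
proof -
  interpret comm_group G by (rule G)
  have "\<exists>c. finite {n \<in> \<iota> ` {..<k}. c n \<noteq> 0} \<and> comb {..<k} z (\<lambda>j. c (\<iota> j)) = h" if h: "h \<in> carrier G" for h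
  proof -
    obtain b where b: "h = comb {..<k} z b" using h gen by (auto simp: combs_def)
    have "comb {..<k} z (\<lambda>j. b (the_inv_into {..<k} \<iota> (\<iota> j))) = h"
      unfolding b using z inj by (intro comb_cong) (auto simp: the_inv_into_f_f)
    moreover have "finite {n \<in> \<iota> ` {..<k}. b (the_inv_into {..<k} \<iota> n) \<noteq> 0}"
      by (rule finite_subset[of _ "\<iota> ` {..<k}"]) auto
    ultimately show ?thesis by (intro exI[of _ "\<lambda>n. b (the_inv_into {..<k} \<iota> n)"] conjI)
  qed
  then show ?thesis
    unfolding presents_def using z
    by (auto simp: comb_closed comb_add indep d intro!: comb_cong)
qed

text \<open>The owner function \<omega> expresses that the blocks \<open>K i\<close> are disjoint,
  and with it coefficient functions chosen on the blocks are glued into one. Since the blocks are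
  finite, finitely many nonzero components give finite support.\<close>

lemma presents_sum_group:
  fixes G :: "'i \<Rightarrow> ('a, 'x) monoid_scheme" and K :: "'i \<Rightarrow> nat set"
  assumes G: "\<And>i. i \<in> I \<Longrightarrow> group (G i)"
    and pres: "\<And>i. i \<in> I \<Longrightarrow> presents (G i) d (K i) (\<phi> i)"
    and fin: "\<And>i. i \<in> I \<Longrightarrow> finite (K i)"
    and owner: "\<And>i n. i \<in> I \<Longrightarrow> n \<in> K i \<Longrightarrow> \<omega> n = i"
  shows "presents (sum_group I G) d (\<Union>i\<in>I. K i) (\<lambda>c. \<lambda>i\<in>I. \<phi> i c)"
proof -
  have cong: "\<phi> i b = \<phi> i c" if "i \<in> I" "\<And>n. n \<in> K i \<Longrightarrow> b n = c n" for i b c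
    using pres[OF that(1)] that(2) unfolding presents_def by blast
  have carr: "\<phi> i c \<in> carrier (G i)" if "i \<in> I" for i c
    using pres[OF that] fin[OF that] unfolding presents_def by simp
  have add: "\<phi> i (\<lambda>n. b n + c n) = \<phi> i b \<otimes>\<^bsub>G i\<^esub> \<phi> i c" if "i \<in> I" for i b c
    using pres[OF that] fin[OF that] unfolding presents_def by simp
  have surj: "\<exists>c. \<phi> i c = h" if "i \<in> I" "h \<in> carrier (G i)" for i h
    using pres[OF that(1)] that(2) unfolding presents_def by blast
  have ker: "\<phi> i c = \<one>\<^bsub>G i\<^esub> \<longleftrightarrow> (\<forall>n\<in>K i. int (d n) dvd c n)" if "i \<in> I" for i c
    using pres[OF that] fin[OF that] unfolding presents_def by simp
  have carrier: "carrier (sum_group I G) = {x \<in> \<Pi>\<^sub>E i\<in>I. carrier (G i). finite {i \<in> I. x i \<noteq> \<one>\<^bsub>G i\<^esub>}}"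
    by (rule carrier_sum_group) (rule G)
  have 1: "(\<lambda>i\<in>I. \<phi> i c) \<in> carrier (sum_group I G)" if c: "finite {n \<in> (\<Union>i\<in>I. K i). c n \<noteq> 0}" for c
  proof -
    have "i \<in> \<omega> ` {n \<in> (\<Union>i\<in>I. K i). c n \<noteq> 0}" if i: "i \<in> I" "\<phi> i c \<noteq> \<one>\<^bsub>G i\<^esub>" for i
    proof -
      obtain n where "n \<in> K i" "\<not> int (d n) dvd c n" using ker[OF i(1), of c] i(2) by blast
      moreover from this have "c n \<noteq> 0" by (metis dvd_0_right)
      ultimately show ?thesis using owner[OF i(1)] i(1) by (intro rev_image_eqI[of n]) auto
    qed
    then have "{i \<in> I. (\<lambda>i\<in>I. \<phi> i c) i \<noteq> \<one>\<^bsub>G i\<^esub>} \<subseteq> \<omega> ` {n \<in> (\<Union>i\<in>I. K i). c n \<noteq> 0}"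
      by auto
    then have "finite {i \<in> I. (\<lambda>i\<in>I. \<phi> i c) i \<noteq> \<one>\<^bsub>G i\<^esub>}"
      by (rule finite_subset) (use c in simp)
    moreover have "(\<lambda>i\<in>I. \<phi> i c) \<in> (\<Pi>\<^sub>E i\<in>I. carrier (G i))" using carr by auto
    ultimately show ?thesis unfolding carrier by blast
  qed
  have 2: "\<exists>c. finite {n \<in> (\<Union>i\<in>I. K i). c n \<noteq> 0} \<and> (\<lambda>i\<in>I. \<phi> i c) = h"
    if h: "h \<in> carrier (sum_group I G)" for h
  proof -
    have h: "h \<in> (\<Pi>\<^sub>E i\<in>I. carrier (G i))" "finite {i \<in> I. h i \<noteq> \<one>\<^bsub>G i\<^esub>}"
      using h by (auto simp: carrier)
    \<comment> \<open>Trivial components receive the zero function; otherwise the glued function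
      could have infinite support.\<close>
    have "\<exists>c. \<phi> i c = h i \<and> (h i = \<one>\<^bsub>G i\<^esub> \<longrightarrow> c = (\<lambda>_. 0))" if i: "i \<in> I" for i
    proof (cases "h i = \<one>\<^bsub>G i\<^esub>")
      case True
      then show ?thesis using ker[OF i, of "\<lambda>_. 0"] by auto
    next
      case False
      have "h i \<in> carrier (G i)" using h i by auto
      then show ?thesis using surj[OF i] False by blast
    qed
    then obtain c where c: "\<And>i. i \<in> I \<Longrightarrow> \<phi> i (c i) = h i"
      "\<And>i. i \<in> I \<Longrightarrow> h i = \<one>\<^bsub>G i\<^esub> \<Longrightarrow> c i = (\<lambda>_. 0)" by metis
    define e where "e n = c (\<omega> n) n" for n
    have e: "e n = c i n" if "i \<in> I" "n \<in> K i" for i n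
      using owner[OF that] by (simp add: e_def)
    have "{n \<in> (\<Union>i\<in>I. K i). e n \<noteq> 0} \<subseteq> (\<Union>i\<in>{i \<in> I. h i \<noteq> \<one>\<^bsub>G i\<^esub>}. K i)"
    proof
      fix n assume "n \<in> {n \<in> (\<Union>i\<in>I. K i). e n \<noteq> 0}"
      then obtain i where i: "i \<in> I" "n \<in> K i" "e n \<noteq> 0" by blast
      then have "h i \<noteq> \<one>\<^bsub>G i\<^esub>" using e[OF i(1,2)] c(2)[OF i(1)] by auto
      then show "n \<in> (\<Union>i\<in>{i \<in> I. h i \<noteq> \<one>\<^bsub>G i\<^esub>}. K i)" using i by blast
    qed
    then have "finite {n \<in> (\<Union>i\<in>I. K i). e n \<noteq> 0}"
      by (rule finite_subset) (use h(2) fin in auto)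
    moreover have "(\<lambda>i\<in>I. \<phi> i e) = h"
    proof (rule PiE_ext[OF _ h(1)])
      show "(\<lambda>i\<in>I. \<phi> i e) \<in> (\<Pi>\<^sub>E i\<in>I. carrier (G i))" using carr by auto
      fix i assume i: "i \<in> I"
      have "\<phi> i e = \<phi> i (c i)" by (rule cong[OF i]) (rule e[OF i])
      then show "(\<lambda>i\<in>I. \<phi> i e) i = h i" using c(1)[OF i] i by simp
    qed
    ultimately show ?thesis by blast
  qed
  have 3: "(\<lambda>i\<in>I. \<phi> i c) = \<one>\<^bsub>sum_group I G\<^esub> \<longleftrightarrow> (\<forall>n\<in>(\<Union>i\<in>I. K i). int (d n) dvd c n)" for c
  proof -
    have "(\<lambda>i\<in>I. \<phi> i c) = \<one>\<^bsub>sum_group I G\<^esub> \<longleftrightarrow> (\<forall>i\<in>I. \<phi> i c = \<one>\<^bsub>G i\<^esub>)"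
      by (auto simp: fun_eq_iff restrict_def)
    then show ?thesis using ker by simp
  qed
  have 4: "(\<lambda>i\<in>I. \<phi> i (\<lambda>n. b n + c n)) = (\<lambda>i\<in>I. \<phi> i b) \<otimes>\<^bsub>sum_group I G\<^esub> (\<lambda>i\<in>I. \<phi> i c)" for b c
    using add by (auto simp: fun_eq_iff restrict_def)
  have 5: "(\<lambda>i\<in>I. \<phi> i b) = (\<lambda>i\<in>I. \<phi> i c)" if "\<forall>n\<in>(\<Union>i\<in>I. K i). b n = c n" for b c
    by (rule restrict_ext) (use that cong in blast)
  show ?thesis unfolding presents_def
    by (intro conjI allI impI ballI) (erule 5, erule 1, rule 4, erule 2, rule 3)
qed

theorem mainTheorem19:
  fixes I :: "'i set" and G :: "'i \<Rightarrow> 'a monoid"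
  assumes "countable I"
    and "\<And>i. i \<in> I \<Longrightarrow> comm_group (G i)"
    and "\<And>i. i \<in> I \<Longrightarrow> finitely_generated_group (G i)"
  shows "\<exists>R. pure_polynomial_krull_domain R \<and> class_group R \<cong> sum_group I G \<and>
           (\<forall>i\<in>I. \<exists>S. mult_subset_int S \<and> pure_polynomial_krull_domain (localize R S) \<and>
                        class_group (localize R S) \<cong> G i)"
proof -
  have group: "group (G i)" if "i \<in> I" for i using assms(2)[OF that] by (simp add: comm_group_def)
  have "\<exists>(k::nat) z \<delta>. z \<in> {..<k} \<rightarrow> carrier (G i) \<and> comm_group.combs (G i) {..<k} z = carrier (G i) \<and>
      (\<forall>c. comm_group.comb (G i) {..<k} z c = \<one>\<^bsub>G i\<^esub> \<longleftrightarrow> (\<forall>j<k. int (\<delta> j) dvd c j))"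
    if "i \<in> I" for i
    using comm_group.finitely_generated_decomposition[OF assms(2,3)[OF that]] .
  then obtain k z \<delta> where
    z: "\<And>i. i \<in> I \<Longrightarrow> z i \<in> {..<k i :: nat} \<rightarrow> carrier (G i)" and
    gen: "\<And>i. i \<in> I \<Longrightarrow> comm_group.combs (G i) {..<k i} (z i) = carrier (G i)" and
    indep: "\<And>i c. i \<in> I \<Longrightarrow> comm_group.comb (G i) {..<k i} (z i) c = \<one>\<^bsub>G i\<^esub> \<longleftrightarrow>
      (\<forall>j<k i. int (\<delta> i j) dvd c j)"
    by metis
  \<comment> \<open>Pairing the number of i with j reserves a separate prime for every cyclic
    summand of every group; \<omega> recovers i from the index of the prime.\<close>
  define \<iota> where "\<iota> i j = prod_encode (to_nat_on I i, j)" for i and j :: nat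
  define \<omega> where "\<omega> n = from_nat_into I (fst (prod_decode n))" for n
  define d where "d n = \<delta> (\<omega> n) (snd (prod_decode n))" for n
  define K where "K i = \<iota> i ` {..<k i}" for i
  define \<phi> where "\<phi> i c = comm_group.comb (G i) {..<k i} (z i) (\<lambda>j. c (\<iota> i j))" for i and c :: "nat \<Rightarrow> int"
  have \<omega>: "\<omega> (\<iota> i j) = i" if "i \<in> I" for i j
    using that assms(1) by (simp add: \<omega>_def \<iota>_def)
  have pres: "presents (G i) d (K i) (\<phi> i)" if i: "i \<in> I" for i
    unfolding K_def \<phi>_def
  proof (rule presents_decomposition[OF assms(2)[OF i] z[OF i] gen[OF i] indep[OF i]])
    show "inj_on (\<iota> i) {..<k i}" by (auto simp: inj_on_def \<iota>_def)
    show "d (\<iota> i j) = \<delta> i j" for j using \<omega>[OF i] by (simp add: d_def) (simp add: \<iota>_def)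
  qed
  let ?M = "\<Union>i\<in>I. K i"
  have "presents (sum_group I G) d ?M (\<lambda>c. \<lambda>i\<in>I. \<phi> i c)"
    by (rule presents_sum_group[where \<omega> = \<omega>]) (use group pres \<omega> in \<open>auto simp: K_def\<close>)
  then have "class_group (kring d ?M) \<cong> sum_group I G"
    by (intro class_group_kring sum_group group)
  moreover have "mult_subset_int (away (K i)) \<and> pure_polynomial_krull_domain (localize (kring d ?M) (away (K i))) \<and>
      class_group (localize (kring d ?M) (away (K i))) \<cong> G i" if i: "i \<in> I" for i
  proof -
    have "localize (kring d ?M) (away (K i)) = kring d (K i)"
      by (rule localize_kring) (use i in blast)
    then show ?thesis
      using mult_subset_away pure_polynomial_krull_domain_kring class_group_kring[OF group[OF i] pres[OF i]] by simp
  qed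
  ultimately show ?thesis using pure_polynomial_krull_domain_kring by blast
qed

end
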